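(* Let $\bar\pi=\{\bar\delta_0,\dots,\bar\delta_N\}$ be a periodic triggering policy with period $k_p$, and let $\pi^+$ be the triggering policy $\delta_k^+=\mathbf{1}_{\{\mathrm{VoI}^{\bar\pi}_k\ge0\}}$, where $\mathrm{VoI}^{\bar\pi}_k$ is the value of information with $\varrho_k$ replaced by $\varrho^{\bar\pi}_k$. Then, in both the perfect and the imperfect information settings, $\Psi(\pi^+,\mu^* )\le\Psi(\bar\pi,\mu^* )$, where $\mu^*$ is the control policy $u_k=-L_k\hat x_k$.
   Context: Setting (common): $x_{k+1}=A_kx_k+B_ku_k+w_k$, $k=0,\dots,N$, $x_0\sim\mathcal N(m_0,M_0)$, $w_k$ i.i.d. $\mathcal N(0,W_k)$, $W_k\succ0$, $(A_k,B_k)$ controllable; an event trigger chooses $\delta_k\in\{0,1\}$ and the observation at time $k$ is transmitted to the controller with one-step delay iff $\delta_k=1$; information associated with non-transmitted observations is discarded at the controller. Cost $\Psi(\pi,\mu)=\mathbb{E}\big[x_{N+1}^TQ_{N+1}x_{N+1}+\sum_{k=0}^Nx_k^TQ_kx_k+u_k^TR_ku_k+\theta_k\delta_k\big]$, $Q_k\succeq0$, $R_k\succ0$, $\theta_k\ge0$. Riccati: $S_{N+1}=Q_{N+1}$, $S_k=Q_k+A_k^TS_{k+1}A_k-\Gamma_k$, $\Gamma_k=A_k^TS_{k+1}B_k(B_k^TS_{k+1}B_k+R_k)^{-1}B_k^TS_{k+1}A_k$, $\Gamma_{N+1}=0$, $L_k=(B_k^TS_{k+1}B_k+R_k)^{-1}B_k^TS_{k+1}A_k$.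 Perfect information: observation $x_k$; $\mathcal{I}^e_k=\{x_t:t\le k\}$, $\mathcal{I}^c_k=\{x_t:t<k,\delta_t=1\}$; $\hat x_0=m_0$, $\hat x_k=A_{k-1}\hat x_{k-1}+B_{k-1}u_{k-1}+\delta_{k-1}A_{k-1}(x_{k-1}-\hat x_{k-1})$; $e_k=x_k-\hat x_k$; value of information $\mathrm{VoI}_k=e_k^TA_k^T\Gamma_{k+1}A_ke_k-\theta_k+\varrho_k$. Imperfect information: observation $y_k=C_kx_k+v_k$, $v_k$ i.i.d. $\mathcal N(0,V_k)$, $V_k\succ0$, $(A_k,C_k)$ observable; $\mathcal{I}^e_k=\{y_t:t\le k\}$, $\mathcal{I}^c_k=\{y_t:t<k,\delta_t=1\}$; $\check x_k=\mathbb{E}[x_k\mid\mathcal{I}^e_k]$ (Kalman filter); $\hat x_0=m_0$, $P_0=M_0$, $\hat x_k=A_{k-1}\hat x_{k-1}+B_{k-1}u_{k-1}+\delta_{k-1}K_{k-1}(y_{k-1}-C_{k-1}\hat x_{k-1})$, $P_k=A_{k-1}P_{k-1}A_{k-1}^T+W_{k-1}-\delta_{k-1}K_{k-1}C_{k-1}P_{k-1}A_{k-1}^T$, $K_k=A_kP_kC_k^T(C_kP_kC_k^T+V_k)^{-1}$; $e_k=x_k-\hat x_k$, $\nu_k=y_k-C_k\hat x_k$, $\varepsilon_k=\check x_k-\hat x_k$; value of information $\mathrm{VoI}_k=\nu_k^TK_k^T\Gamma_{k+1}(2A_k\varepsilon_k-K_k\nu_k)-\theta_k+\varrho_k$. Approximation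 (Algorithm 1): for the periodic policy $\bar\pi$, $\varrho^{\bar\pi}_k=\mathbb{E}[V^{\bar\pi}_{k+1}\mid\mathcal{I}^e_k,\delta_k=0]-\mathbb{E}[V^{\bar\pi}_{k+1}\mid\mathcal{I}^e_k,\delta_k=1]$ where $\mathbb{E}[V^{\bar\pi}_{k+1}\mid\mathcal{I}^e_k,\delta_k]=\mathbb{E}\big[\sum_{t=k+1}^N\theta_t\delta_t+e_{t+1}^T\Gamma_{t+1}e_{t+1}\mid\mathcal{I}^e_k,\delta_k\big]$ computed with $\delta_t=\bar\delta_t$ for all $t\ge k+1$ and control $u_t=-L_t\hat x_t$. *)

theory Defs
  imports "HOL-Probability.Probability"
begin

section \<open>Matrix notions\<close>

text \<open>Symmetric positive semidefinite / positive definite matrices.\<close>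
definition psd_mat :: "real^'n^'n \<Rightarrow> bool" where
  "psd_mat S \<longleftrightarrow> transpose S = S \<and> (\<forall>x. 0 \<le> x \<bullet> (S *v x))"

definition pd_mat :: "real^'n^'n \<Rightarrow> bool" where
  "pd_mat S \<longleftrightarrow> transpose S = S \<and> (\<forall>x. x \<noteq> 0 \<longrightarrow> 0 < x \<bullet> (S *v x))"

text \<open>(A,B) controllable: the controllability matrix [B, AB, ..., A^(n-1) B] has full rank n,
  i.e. its range is the whole state space.\<close>
definition controllable :: "real^'n^'n \<Rightarrow> real^'m^'n \<Rightarrow> bool" where
  "controllable A B \<longleftrightarrow>
     (\<forall>z. \<exists>u :: nat \<Rightarrow> real^'m. z = (\<Sum>i<CARD('n). (((*v) A) ^^ i) (B *v u i)))"

text \<open>(A,C) observable: the observability matrix [C; CA; ...; C A^(n-1)] has trivial kernel.\<close>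
definition observable :: "real^'n^'n \<Rightarrow> real^'n^'p \<Rightarrow> bool" where
  "observable A C \<longleftrightarrow>
     (\<forall>x. (\<forall>i<CARD('n). C *v ((((*v) A) ^^ i) x) = 0) \<longrightarrow> x = 0)"

section \<open>Gaussian random vectors\<close>

text \<open>X ~ N(m, Sig) (possibly degenerate): every linear functional a.X is normal with mean a.m and
  variance a'Sig a (a.s. constant if the variance is 0).\<close>
definition gaussian_rv :: "'w measure \<Rightarrow> ('w \<Rightarrow> real^'n) \<Rightarrow> real^'n \<Rightarrow> real^'n^'n \<Rightarrow> bool" where
  "gaussian_rv M X m Sig \<longleftrightarrow> X \<in> borel_measurable M \<and>
     (\<forall>a. if a \<bullet> (Sig *v a) = 0 then (AE \<omega> in M. a \<bullet> X \<omega> = a \<bullet> m)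
          else distributed M lborel (\<lambda>\<omega>. a \<bullet> X \<omega>)
                 (\<lambda>r. ennreal (normal_density (a \<bullet> m) (sqrt (a \<bullet> (Sig *v a))) r)))"

text \<open>Index type for the primitive random variables x0, w_k, v_k.\<close>
datatype noise_idx = X0 | Wn nat | Vn nat

section \<open>Riccati recursion\<close>

definition riccati_step ::
  "(nat \<Rightarrow> real^'n^'n) \<Rightarrow> (nat \<Rightarrow> real^'m^'n) \<Rightarrow> (nat \<Rightarrow> real^'n^'n) \<Rightarrow> (nat \<Rightarrow> real^'m^'m)
   \<Rightarrow> nat \<Rightarrow> real^'n^'n \<Rightarrow> real^'n^'n" where
  "riccati_step A B Q R k S1 =
     Q k + transpose (A k) ** S1 ** A k
     - transpose (A k) ** S1 ** B k ** matrix_inv (transpose (B k) ** S1 ** B k + R k)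
         ** transpose (B k) ** S1 ** A k"

text \<open>ric_back j = S_(N+1-j).\<close>
primrec ric_back ::
  "(nat \<Rightarrow> real^'n^'n) \<Rightarrow> (nat \<Rightarrow> real^'m^'n) \<Rightarrow> (nat \<Rightarrow> real^'n^'n) \<Rightarrow> (nat \<Rightarrow> real^'m^'m)
   \<Rightarrow> nat \<Rightarrow> nat \<Rightarrow> real^'n^'n" where
  "ric_back A B Q R N 0 = Q (Suc N)"
| "ric_back A B Q R N (Suc j) = riccati_step A B Q R (N - j) (ric_back A B Q R N j)"

text \<open>S_k for k = 0..N+1, with S_(N+1) = Q_(N+1).\<close>
definition ricS ::
  "(nat \<Rightarrow> real^'n^'n) \<Rightarrow> (nat \<Rightarrow> real^'m^'n) \<Rightarrow> (nat \<Rightarrow> real^'n^'n) \<Rightarrow> (nat \<Rightarrow> real^'m^'m)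
   \<Rightarrow> nat \<Rightarrow> nat \<Rightarrow> real^'n^'n" where
  "ricS A B Q R N k = ric_back A B Q R N (Suc N - k)"

text \<open>Gamma_k (k = 0..N), Gamma_(N+1) = 0.\<close>
definition ricGamma ::
  "(nat \<Rightarrow> real^'n^'n) \<Rightarrow> (nat \<Rightarrow> real^'m^'n) \<Rightarrow> (nat \<Rightarrow> real^'n^'n) \<Rightarrow> (nat \<Rightarrow> real^'m^'m)
   \<Rightarrow> nat \<Rightarrow> nat \<Rightarrow> real^'n^'n" where
  "ricGamma A B Q R N k =
     (if k = Suc N then 0 else
      (let S1 = ricS A B Q R N (Suc k) in
       transpose (A k) ** S1 ** B k ** matrix_inv (transpose (B k) ** S1 ** B k + R k)
         ** transpose (B k) ** S1 ** A k))"

text \<open>Feedback gain L_k.\<close>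
definition ricL ::
  "(nat \<Rightarrow> real^'n^'n) \<Rightarrow> (nat \<Rightarrow> real^'m^'n) \<Rightarrow> (nat \<Rightarrow> real^'n^'n) \<Rightarrow> (nat \<Rightarrow> real^'m^'m)
   \<Rightarrow> nat \<Rightarrow> nat \<Rightarrow> real^'n^'m" where
  "ricL A B Q R N k =
     (let S1 = ricS A B Q R N (Suc k) in
      matrix_inv (transpose (B k) ** S1 ** B k + R k) ** transpose (B k) ** S1 ** A k)"

section \<open>Trigger sequences\<close>

text \<open>A triggering decision sequence is d :: nat => 'w => bool (delta_k(omega) = 1 iff d k omega).
  The periodic policy is a deterministic sequence dbar with period kp.\<close>
definition periodic_policy :: "nat \<Rightarrow> (nat \<Rightarrow> bool) \<Rightarrow> bool" where
  "periodic_policy kp dbar \<longleftrightarrow> 0 < kp \<and> (\<forall>k. dbar (k + kp) = dbar k)"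

text \<open>Use d before time k, the value b at time k, and the periodic policy dbar after time k.\<close>
definition switch_at :: "(nat \<Rightarrow> 'w \<Rightarrow> bool) \<Rightarrow> nat \<Rightarrow> bool \<Rightarrow> (nat \<Rightarrow> bool) \<Rightarrow> nat \<Rightarrow> 'w \<Rightarrow> bool" where
  "switch_at d k b dbar = (\<lambda>t \<omega>. if t < k then d t \<omega> else if t = k then b else dbar t)"

definition ind :: "bool \<Rightarrow> real" where
  "ind b = (if b then 1 else 0)"

section \<open>Perfect information\<close>

text \<open>Closed loop (x_k, xhat_k) under trigger d and control u_k = - L_k xhat_k.\<close>
primrec pcl ::
  "(nat \<Rightarrow> real^'n^'n) \<Rightarrow> (nat \<Rightarrow> real^'m^'n) \<Rightarrow> (nat \<Rightarrow> real^'n^'m) \<Rightarrow> real^'n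
   \<Rightarrow> ('w \<Rightarrow> real^'n) \<Rightarrow> (nat \<Rightarrow> 'w \<Rightarrow> real^'n) \<Rightarrow> (nat \<Rightarrow> 'w \<Rightarrow> bool)
   \<Rightarrow> nat \<Rightarrow> 'w \<Rightarrow> (real^'n) \<times> (real^'n)" where
  "pcl A B L m0 x0 w d 0 \<omega> = (x0 \<omega>, m0)"
| "pcl A B L m0 x0 w d (Suc k) \<omega> =
     (let x = fst (pcl A B L m0 x0 w d k \<omega>); xh = snd (pcl A B L m0 x0 w d k \<omega>);
          u = - (L k *v xh) in
      (A k *v x + B k *v u + w k \<omega>,
       A k *v xh + B k *v u + (if d k \<omega> then A k *v (x - xh) else 0)))"

text \<open>Realized cost of one sample path under trigger d and control mu*.\<close>
definition pcost ::
  "(nat \<Rightarrow> real^'n^'n) \<Rightarrow> (nat \<Rightarrow> real^'m^'n) \<Rightarrow> (nat \<Rightarrow> real^'n^'n) \<Rightarrow> (nat \<Rightarrow> real^'m^'m)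
   \<Rightarrow> (nat \<Rightarrow> real) \<Rightarrow> nat \<Rightarrow> real^'n \<Rightarrow> ('w \<Rightarrow> real^'n) \<Rightarrow> (nat \<Rightarrow> 'w \<Rightarrow> real^'n)
   \<Rightarrow> (nat \<Rightarrow> 'w \<Rightarrow> bool) \<Rightarrow> 'w \<Rightarrow> real" where
  "pcost A B Q R th N m0 x0 w d \<omega> =
     (let L = ricL A B Q R N;
          x = (\<lambda>k. fst (pcl A B L m0 x0 w d k \<omega>));
          u = (\<lambda>k. - (L k *v snd (pcl A B L m0 x0 w d k \<omega>))) in
      x (Suc N) \<bullet> (Q (Suc N) *v x (Suc N))
      + (\<Sum>k\<le>N. x k \<bullet> (Q k *v x k) + u k \<bullet> (R k *v u k) + th k * ind (d k \<omega>)))"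

text \<open>Psi(pi, mu*) (as a nonnegative extended real expectation).\<close>
definition pPsi ::
  "'w measure \<Rightarrow> (nat \<Rightarrow> real^'n^'n) \<Rightarrow> (nat \<Rightarrow> real^'m^'n) \<Rightarrow> (nat \<Rightarrow> real^'n^'n) \<Rightarrow> (nat \<Rightarrow> real^'m^'m)
   \<Rightarrow> (nat \<Rightarrow> real) \<Rightarrow> nat \<Rightarrow> real^'n \<Rightarrow> ('w \<Rightarrow> real^'n) \<Rightarrow> (nat \<Rightarrow> 'w \<Rightarrow> real^'n)
   \<Rightarrow> (nat \<Rightarrow> 'w \<Rightarrow> bool) \<Rightarrow> ennreal" where
  "pPsi M A B Q R th N m0 x0 w d = (\<integral>\<^sup>+ \<omega>. ennreal (pcost A B Q R th N m0 x0 w d \<omega>) \<partial>M)"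

text \<open>sigma-algebra of the event-trigger information I^e_k = {x_t : t <= k} under trigger d.\<close>
definition pinfo ::
  "'w measure \<Rightarrow> (nat \<Rightarrow> real^'n^'n) \<Rightarrow> (nat \<Rightarrow> real^'m^'n) \<Rightarrow> (nat \<Rightarrow> real^'n^'m) \<Rightarrow> real^'n
   \<Rightarrow> ('w \<Rightarrow> real^'n) \<Rightarrow> (nat \<Rightarrow> 'w \<Rightarrow> real^'n) \<Rightarrow> (nat \<Rightarrow> 'w \<Rightarrow> bool) \<Rightarrow> nat \<Rightarrow> 'w measure" where
  "pinfo M A B L m0 x0 w d k =
     sigma (space M)
       (\<Union>t\<in>{..k}. {(\<lambda>\<omega>. fst (pcl A B L m0 x0 w d t \<omega>)) -` S \<inter> space M | S. S \<in> sets borel})"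

text \<open>Cost-to-go sum_(t=k+1)^N theta_t dbar_t + e_(t+1)' Gamma_(t+1) e_(t+1) when delta_k = b and
  delta_t = dbar_t for t >= k+1 (history before k given by d).\<close>
definition pJ ::
  "(nat \<Rightarrow> real^'n^'n) \<Rightarrow> (nat \<Rightarrow> real^'m^'n) \<Rightarrow> (nat \<Rightarrow> real^'n^'n) \<Rightarrow> (nat \<Rightarrow> real^'m^'m)
   \<Rightarrow> (nat \<Rightarrow> real) \<Rightarrow> nat \<Rightarrow> real^'n \<Rightarrow> ('w \<Rightarrow> real^'n) \<Rightarrow> (nat \<Rightarrow> 'w \<Rightarrow> real^'n)
   \<Rightarrow> (nat \<Rightarrow> bool) \<Rightarrow> (nat \<Rightarrow> 'w \<Rightarrow> bool) \<Rightarrow> nat \<Rightarrow> bool \<Rightarrow> 'w \<Rightarrow> real" where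
  "pJ A B Q R th N m0 x0 w dbar d k b \<omega> =
     (let G = ricGamma A B Q R N;
          e = (\<lambda>t. fst (pcl A B (ricL A B Q R N) m0 x0 w (switch_at d k b dbar) t \<omega>)
                  - snd (pcl A B (ricL A B Q R N) m0 x0 w (switch_at d k b dbar) t \<omega>)) in
      (\<Sum>t\<in>{Suc k..N}. th t * ind (dbar t) + e (Suc t) \<bullet> (G (Suc t) *v e (Suc t))))"

text \<open>rho^pibar_k = E[V_(k+1) | I^e_k, delta_k = 0] - E[V_(k+1) | I^e_k, delta_k = 1].\<close>
definition prho ::
  "'w measure \<Rightarrow> (nat \<Rightarrow> real^'n^'n) \<Rightarrow> (nat \<Rightarrow> real^'m^'n) \<Rightarrow> (nat \<Rightarrow> real^'n^'n) \<Rightarrow> (nat \<Rightarrow> real^'m^'m)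
   \<Rightarrow> (nat \<Rightarrow> real) \<Rightarrow> nat \<Rightarrow> real^'n \<Rightarrow> ('w \<Rightarrow> real^'n) \<Rightarrow> (nat \<Rightarrow> 'w \<Rightarrow> real^'n)
   \<Rightarrow> (nat \<Rightarrow> bool) \<Rightarrow> (nat \<Rightarrow> 'w \<Rightarrow> bool) \<Rightarrow> nat \<Rightarrow> 'w \<Rightarrow> real" where
  "prho M A B Q R th N m0 x0 w dbar d k \<omega> =
     (let F = pinfo M A B (ricL A B Q R N) m0 x0 w d k in
      real_cond_exp M F (pJ A B Q R th N m0 x0 w dbar d k False) \<omega>
      - real_cond_exp M F (pJ A B Q R th N m0 x0 w dbar d k True) \<omega>)"

text \<open>VoI^pibar_k = e_k' A_k' Gamma_(k+1) A_k e_k - theta_k + rho^pibar_k.\<close>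
definition pVoI ::
  "'w measure \<Rightarrow> (nat \<Rightarrow> real^'n^'n) \<Rightarrow> (nat \<Rightarrow> real^'m^'n) \<Rightarrow> (nat \<Rightarrow> real^'n^'n) \<Rightarrow> (nat \<Rightarrow> real^'m^'m)
   \<Rightarrow> (nat \<Rightarrow> real) \<Rightarrow> nat \<Rightarrow> real^'n \<Rightarrow> ('w \<Rightarrow> real^'n) \<Rightarrow> (nat \<Rightarrow> 'w \<Rightarrow> real^'n)
   \<Rightarrow> (nat \<Rightarrow> bool) \<Rightarrow> (nat \<Rightarrow> 'w \<Rightarrow> bool) \<Rightarrow> nat \<Rightarrow> 'w \<Rightarrow> real" where
  "pVoI M A B Q R th N m0 x0 w dbar d k \<omega> =
     (let st = pcl A B (ricL A B Q R N) m0 x0 w d k \<omega>; e = fst st - snd st in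
      (A k *v e) \<bullet> (ricGamma A B Q R N (Suc k) *v (A k *v e)) - th k
      + prho M A B Q R th N m0 x0 w dbar d k \<omega>)"

text \<open>pi^+: delta^+_k = 1 iff VoI^pibar_k >= 0, evaluated along the closed loop of pi^+ itself.
  pplus_pre k holds the decisions at times < k.\<close>
primrec pplus_pre ::
  "'w measure \<Rightarrow> (nat \<Rightarrow> real^'n^'n) \<Rightarrow> (nat \<Rightarrow> real^'m^'n) \<Rightarrow> (nat \<Rightarrow> real^'n^'n) \<Rightarrow> (nat \<Rightarrow> real^'m^'m)
   \<Rightarrow> (nat \<Rightarrow> real) \<Rightarrow> nat \<Rightarrow> real^'n \<Rightarrow> ('w \<Rightarrow> real^'n) \<Rightarrow> (nat \<Rightarrow> 'w \<Rightarrow> real^'n)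
   \<Rightarrow> (nat \<Rightarrow> bool) \<Rightarrow> nat \<Rightarrow> nat \<Rightarrow> 'w \<Rightarrow> bool" where
  "pplus_pre M A B Q R th N m0 x0 w dbar 0 = (\<lambda>_ _. False)"
| "pplus_pre M A B Q R th N m0 x0 w dbar (Suc k) =
     (pplus_pre M A B Q R th N m0 x0 w dbar k)
       (k := (\<lambda>\<omega>. 0 \<le> pVoI M A B Q R th N m0 x0 w dbar (pplus_pre M A B Q R th N m0 x0 w dbar k) k \<omega>))"

definition pplus ::
  "'w measure \<Rightarrow> (nat \<Rightarrow> real^'n^'n) \<Rightarrow> (nat \<Rightarrow> real^'m^'n) \<Rightarrow> (nat \<Rightarrow> real^'n^'n) \<Rightarrow> (nat \<Rightarrow> real^'m^'m)
   \<Rightarrow> (nat \<Rightarrow> real) \<Rightarrow> nat \<Rightarrow> real^'n \<Rightarrow> ('w \<Rightarrow> real^'n) \<Rightarrow> (nat \<Rightarrow> 'w \<Rightarrow> real^'n)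
   \<Rightarrow> (nat \<Rightarrow> bool) \<Rightarrow> nat \<Rightarrow> 'w \<Rightarrow> bool" where
  "pplus M A B Q R th N m0 x0 w dbar k = pplus_pre M A B Q R th N m0 x0 w dbar (Suc k) k"

text \<open>Standing assumptions, perfect information setting.\<close>
definition perfect_model ::
  "'w measure \<Rightarrow> (nat \<Rightarrow> real^'n^'n) \<Rightarrow> (nat \<Rightarrow> real^'m^'n) \<Rightarrow> (nat \<Rightarrow> real^'n^'n) \<Rightarrow> (nat \<Rightarrow> real^'m^'m)
   \<Rightarrow> (nat \<Rightarrow> real^'n^'n) \<Rightarrow> (nat \<Rightarrow> real) \<Rightarrow> nat \<Rightarrow> real^'n \<Rightarrow> real^'n^'n
   \<Rightarrow> ('w \<Rightarrow> real^'n) \<Rightarrow> (nat \<Rightarrow> 'w \<Rightarrow> real^'n) \<Rightarrow> bool" where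
  "perfect_model M A B Q R W th N m0 M0 x0 w \<longleftrightarrow>
     prob_space M
     \<and> (\<forall>k\<le>Suc N. psd_mat (Q k))
     \<and> (\<forall>k\<le>N. pd_mat (R k) \<and> pd_mat (W k) \<and> 0 \<le> th k \<and> controllable (A k) (B k))
     \<and> psd_mat M0
     \<and> gaussian_rv M x0 m0 M0
     \<and> (\<forall>k\<le>N. gaussian_rv M (w k) 0 (W k))
     \<and> prob_space.indep_vars M (\<lambda>_. borel)
          (\<lambda>i. case i of X0 \<Rightarrow> x0 | Wn k \<Rightarrow> w k | Vn k \<Rightarrow> x0)
          (insert X0 (Wn ` {..N}))"

section \<open>Imperfect information\<close>

definition kgain ::
  "(nat \<Rightarrow> real^'n^'n) \<Rightarrow> (nat \<Rightarrow> real^'n^'p) \<Rightarrow> (nat \<Rightarrow> real^'p^'p) \<Rightarrow> nat \<Rightarrow> real^'n^'n \<Rightarrow> real^'p^'n" where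
  "kgain A C V k P = A k ** P ** transpose (C k) ** matrix_inv (C k ** P ** transpose (C k) + V k)"

text \<open>Closed loop (x_k, xhat_k, P_k) under trigger d and control u_k = - L_k xhat_k.\<close>
primrec icl ::
  "(nat \<Rightarrow> real^'n^'n) \<Rightarrow> (nat \<Rightarrow> real^'m^'n) \<Rightarrow> (nat \<Rightarrow> real^'n^'p) \<Rightarrow> (nat \<Rightarrow> real^'n^'n)
   \<Rightarrow> (nat \<Rightarrow> real^'p^'p) \<Rightarrow> (nat \<Rightarrow> real^'n^'m) \<Rightarrow> real^'n \<Rightarrow> real^'n^'n
   \<Rightarrow> ('w \<Rightarrow> real^'n) \<Rightarrow> (nat \<Rightarrow> 'w \<Rightarrow> real^'n) \<Rightarrow> (nat \<Rightarrow> 'w \<Rightarrow> real^'p) \<Rightarrow> (nat \<Rightarrow> 'w \<Rightarrow> bool)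
   \<Rightarrow> nat \<Rightarrow> 'w \<Rightarrow> (real^'n) \<times> (real^'n) \<times> (real^'n^'n)" where
  "icl A B C W V L m0 M0 x0 w v d 0 \<omega> = (x0 \<omega>, m0, M0)"
| "icl A B C W V L m0 M0 x0 w v d (Suc k) \<omega> =
     (let (x, xh, P) = icl A B C W V L m0 M0 x0 w v d k \<omega>;
          u = - (L k *v xh); y = C k *v x + v k \<omega>; K = kgain A C V k P in
      (A k *v x + B k *v u + w k \<omega>,
       A k *v xh + B k *v u + (if d k \<omega> then K *v (y - C k *v xh) else 0),
       A k ** P ** transpose (A k) + W k - (if d k \<omega> then K ** C k ** P ** transpose (A k) else 0)))"

definition icost ::
  "(nat \<Rightarrow> real^'n^'n) \<Rightarrow> (nat \<Rightarrow> real^'m^'n) \<Rightarrow> (nat \<Rightarrow> real^'n^'p) \<Rightarrow> (nat \<Rightarrow> real^'n^'n) \<Rightarrow> (nat \<Rightarrow> real^'p^'p)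
   \<Rightarrow> (nat \<Rightarrow> real^'n^'n) \<Rightarrow> (nat \<Rightarrow> real^'m^'m) \<Rightarrow> (nat \<Rightarrow> real) \<Rightarrow> nat \<Rightarrow> real^'n \<Rightarrow> real^'n^'n
   \<Rightarrow> ('w \<Rightarrow> real^'n) \<Rightarrow> (nat \<Rightarrow> 'w \<Rightarrow> real^'n) \<Rightarrow> (nat \<Rightarrow> 'w \<Rightarrow> real^'p) \<Rightarrow> (nat \<Rightarrow> 'w \<Rightarrow> bool)
   \<Rightarrow> 'w \<Rightarrow> real" where
  "icost A B C W V Q R th N m0 M0 x0 w v d \<omega> =
     (let L = ricL A B Q R N;
          x = (\<lambda>k. fst (icl A B C W V L m0 M0 x0 w v d k \<omega>));
          u = (\<lambda>k. - (L k *v fst (snd (icl A B C W V L m0 M0 x0 w v d k \<omega>)))) in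
      x (Suc N) \<bullet> (Q (Suc N) *v x (Suc N))
      + (\<Sum>k\<le>N. x k \<bullet> (Q k *v x k) + u k \<bullet> (R k *v u k) + th k * ind (d k \<omega>)))"

definition iPsi ::
  "'w measure \<Rightarrow> (nat \<Rightarrow> real^'n^'n) \<Rightarrow> (nat \<Rightarrow> real^'m^'n) \<Rightarrow> (nat \<Rightarrow> real^'n^'p) \<Rightarrow> (nat \<Rightarrow> real^'n^'n) \<Rightarrow> (nat \<Rightarrow> real^'p^'p)
   \<Rightarrow> (nat \<Rightarrow> real^'n^'n) \<Rightarrow> (nat \<Rightarrow> real^'m^'m) \<Rightarrow> (nat \<Rightarrow> real) \<Rightarrow> nat \<Rightarrow> real^'n \<Rightarrow> real^'n^'n
   \<Rightarrow> ('w \<Rightarrow> real^'n) \<Rightarrow> (nat \<Rightarrow> 'w \<Rightarrow> real^'n) \<Rightarrow> (nat \<Rightarrow> 'w \<Rightarrow> real^'p) \<Rightarrow> (nat \<Rightarrow> 'w \<Rightarrow> bool)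
   \<Rightarrow> ennreal" where
  "iPsi M A B C W V Q R th N m0 M0 x0 w v d =
     (\<integral>\<^sup>+ \<omega>. ennreal (icost A B C W V Q R th N m0 M0 x0 w v d \<omega>) \<partial>M)"

text \<open>sigma-algebra of I^e_k = {y_t : t <= k}, y_t = C_t x_t + v_t, under trigger d.\<close>
definition iinfo ::
  "'w measure \<Rightarrow> (nat \<Rightarrow> real^'n^'n) \<Rightarrow> (nat \<Rightarrow> real^'m^'n) \<Rightarrow> (nat \<Rightarrow> real^'n^'p) \<Rightarrow> (nat \<Rightarrow> real^'n^'n)
   \<Rightarrow> (nat \<Rightarrow> real^'p^'p) \<Rightarrow> (nat \<Rightarrow> real^'n^'m) \<Rightarrow> real^'n \<Rightarrow> real^'n^'n
   \<Rightarrow> ('w \<Rightarrow> real^'n) \<Rightarrow> (nat \<Rightarrow> 'w \<Rightarrow> real^'n) \<Rightarrow> (nat \<Rightarrow> 'w \<Rightarrow> real^'p) \<Rightarrow> (nat \<Rightarrow> 'w \<Rightarrow> bool)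
   \<Rightarrow> nat \<Rightarrow> 'w measure" where
  "iinfo M A B C W V L m0 M0 x0 w v d k =
     sigma (space M)
       (\<Union>t\<in>{..k}. {(\<lambda>\<omega>. C t *v fst (icl A B C W V L m0 M0 x0 w v d t \<omega>) + v t \<omega>) -` S \<inter> space M
                    | S. S \<in> sets borel})"

definition iJ ::
  "(nat \<Rightarrow> real^'n^'n) \<Rightarrow> (nat \<Rightarrow> real^'m^'n) \<Rightarrow> (nat \<Rightarrow> real^'n^'p) \<Rightarrow> (nat \<Rightarrow> real^'n^'n) \<Rightarrow> (nat \<Rightarrow> real^'p^'p)
   \<Rightarrow> (nat \<Rightarrow> real^'n^'n) \<Rightarrow> (nat \<Rightarrow> real^'m^'m) \<Rightarrow> (nat \<Rightarrow> real) \<Rightarrow> nat \<Rightarrow> real^'n \<Rightarrow> real^'n^'n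
   \<Rightarrow> ('w \<Rightarrow> real^'n) \<Rightarrow> (nat \<Rightarrow> 'w \<Rightarrow> real^'n) \<Rightarrow> (nat \<Rightarrow> 'w \<Rightarrow> real^'p)
   \<Rightarrow> (nat \<Rightarrow> bool) \<Rightarrow> (nat \<Rightarrow> 'w \<Rightarrow> bool) \<Rightarrow> nat \<Rightarrow> bool \<Rightarrow> 'w \<Rightarrow> real" where
  "iJ A B C W V Q R th N m0 M0 x0 w v dbar d k b \<omega> =
     (let G = ricGamma A B Q R N;
          st = (\<lambda>t. icl A B C W V (ricL A B Q R N) m0 M0 x0 w v (switch_at d k b dbar) t \<omega>);
          e = (\<lambda>t. fst (st t) - fst (snd (st t))) in
      (\<Sum>t\<in>{Suc k..N}. th t * ind (dbar t) + e (Suc t) \<bullet> (G (Suc t) *v e (Suc t))))"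

definition irho ::
  "'w measure \<Rightarrow> (nat \<Rightarrow> real^'n^'n) \<Rightarrow> (nat \<Rightarrow> real^'m^'n) \<Rightarrow> (nat \<Rightarrow> real^'n^'p) \<Rightarrow> (nat \<Rightarrow> real^'n^'n) \<Rightarrow> (nat \<Rightarrow> real^'p^'p)
   \<Rightarrow> (nat \<Rightarrow> real^'n^'n) \<Rightarrow> (nat \<Rightarrow> real^'m^'m) \<Rightarrow> (nat \<Rightarrow> real) \<Rightarrow> nat \<Rightarrow> real^'n \<Rightarrow> real^'n^'n
   \<Rightarrow> ('w \<Rightarrow> real^'n) \<Rightarrow> (nat \<Rightarrow> 'w \<Rightarrow> real^'n) \<Rightarrow> (nat \<Rightarrow> 'w \<Rightarrow> real^'p)
   \<Rightarrow> (nat \<Rightarrow> bool) \<Rightarrow> (nat \<Rightarrow> 'w \<Rightarrow> bool) \<Rightarrow> nat \<Rightarrow> 'w \<Rightarrow> real" where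
  "irho M A B C W V Q R th N m0 M0 x0 w v dbar d k \<omega> =
     (let F = iinfo M A B C W V (ricL A B Q R N) m0 M0 x0 w v d k in
      real_cond_exp M F (iJ A B C W V Q R th N m0 M0 x0 w v dbar d k False) \<omega>
      - real_cond_exp M F (iJ A B C W V Q R th N m0 M0 x0 w v dbar d k True) \<omega>)"

text \<open>VoI^pibar_k = nu_k' K_k' Gamma_(k+1) (2 A_k eps_k - K_k nu_k) - theta_k + rho^pibar_k, with
  xcheck_k = E[x_k | I^e_k] (componentwise conditional expectation), eps_k = xcheck_k - xhat_k,
  nu_k = y_k - C_k xhat_k, K_k = A_k P_k C_k' (C_k P_k C_k' + V_k)^-1.\<close>
definition iVoI ::
  "'w measure \<Rightarrow> (nat \<Rightarrow> real^'n^'n) \<Rightarrow> (nat \<Rightarrow> real^'m^'n) \<Rightarrow> (nat \<Rightarrow> real^'n^'p) \<Rightarrow> (nat \<Rightarrow> real^'n^'n) \<Rightarrow> (nat \<Rightarrow> real^'p^'p)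
   \<Rightarrow> (nat \<Rightarrow> real^'n^'n) \<Rightarrow> (nat \<Rightarrow> real^'m^'m) \<Rightarrow> (nat \<Rightarrow> real) \<Rightarrow> nat \<Rightarrow> real^'n \<Rightarrow> real^'n^'n
   \<Rightarrow> ('w \<Rightarrow> real^'n) \<Rightarrow> (nat \<Rightarrow> 'w \<Rightarrow> real^'n) \<Rightarrow> (nat \<Rightarrow> 'w \<Rightarrow> real^'p)
   \<Rightarrow> (nat \<Rightarrow> bool) \<Rightarrow> (nat \<Rightarrow> 'w \<Rightarrow> bool) \<Rightarrow> nat \<Rightarrow> 'w \<Rightarrow> real" where
  "iVoI M A B C W V Q R th N m0 M0 x0 w v dbar d k \<omega> =
     (let L = ricL A B Q R N;
          st = icl A B C W V L m0 M0 x0 w v d k \<omega>;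
          xh = fst (snd st); P = snd (snd st);
          F = iinfo M A B C W V L m0 M0 x0 w v d k;
          xc = (\<chi> i. real_cond_exp M F (\<lambda>\<omega>'. fst (icl A B C W V L m0 M0 x0 w v d k \<omega>') $ i) \<omega>);
          eps = xc - xh;
          nu = C k *v fst st + v k \<omega> - C k *v xh;
          K = kgain A C V k P in
      (K *v nu) \<bullet> (ricGamma A B Q R N (Suc k) *v (2 *\<^sub>R (A k *v eps) - K *v nu)) - th k
      + irho M A B C W V Q R th N m0 M0 x0 w v dbar d k \<omega>)"

primrec iplus_pre ::
  "'w measure \<Rightarrow> (nat \<Rightarrow> real^'n^'n) \<Rightarrow> (nat \<Rightarrow> real^'m^'n) \<Rightarrow> (nat \<Rightarrow> real^'n^'p) \<Rightarrow> (nat \<Rightarrow> real^'n^'n) \<Rightarrow> (nat \<Rightarrow> real^'p^'p)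
   \<Rightarrow> (nat \<Rightarrow> real^'n^'n) \<Rightarrow> (nat \<Rightarrow> real^'m^'m) \<Rightarrow> (nat \<Rightarrow> real) \<Rightarrow> nat \<Rightarrow> real^'n \<Rightarrow> real^'n^'n
   \<Rightarrow> ('w \<Rightarrow> real^'n) \<Rightarrow> (nat \<Rightarrow> 'w \<Rightarrow> real^'n) \<Rightarrow> (nat \<Rightarrow> 'w \<Rightarrow> real^'p)
   \<Rightarrow> (nat \<Rightarrow> bool) \<Rightarrow> nat \<Rightarrow> nat \<Rightarrow> 'w \<Rightarrow> bool" where
  "iplus_pre M A B C W V Q R th N m0 M0 x0 w v dbar 0 = (\<lambda>_ _. False)"
| "iplus_pre M A B C W V Q R th N m0 M0 x0 w v dbar (Suc k) =
     (iplus_pre M A B C W V Q R th N m0 M0 x0 w v dbar k)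
       (k := (\<lambda>\<omega>. 0 \<le> iVoI M A B C W V Q R th N m0 M0 x0 w v dbar
                          (iplus_pre M A B C W V Q R th N m0 M0 x0 w v dbar k) k \<omega>))"

definition iplus ::
  "'w measure \<Rightarrow> (nat \<Rightarrow> real^'n^'n) \<Rightarrow> (nat \<Rightarrow> real^'m^'n) \<Rightarrow> (nat \<Rightarrow> real^'n^'p) \<Rightarrow> (nat \<Rightarrow> real^'n^'n) \<Rightarrow> (nat \<Rightarrow> real^'p^'p)
   \<Rightarrow> (nat \<Rightarrow> real^'n^'n) \<Rightarrow> (nat \<Rightarrow> real^'m^'m) \<Rightarrow> (nat \<Rightarrow> real) \<Rightarrow> nat \<Rightarrow> real^'n \<Rightarrow> real^'n^'n
   \<Rightarrow> ('w \<Rightarrow> real^'n) \<Rightarrow> (nat \<Rightarrow> 'w \<Rightarrow> real^'n) \<Rightarrow> (nat \<Rightarrow> 'w \<Rightarrow> real^'p)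
   \<Rightarrow> (nat \<Rightarrow> bool) \<Rightarrow> nat \<Rightarrow> 'w \<Rightarrow> bool" where
  "iplus M A B C W V Q R th N m0 M0 x0 w v dbar k =
     iplus_pre M A B C W V Q R th N m0 M0 x0 w v dbar (Suc k) k"

text \<open>Additional standing assumptions of the imperfect information setting.\<close>
definition imperfect_model ::
  "'w measure \<Rightarrow> (nat \<Rightarrow> real^'n^'n) \<Rightarrow> (nat \<Rightarrow> real^'n^'p) \<Rightarrow> (nat \<Rightarrow> real^'p^'p) \<Rightarrow> nat
   \<Rightarrow> ('w \<Rightarrow> real^'n) \<Rightarrow> (nat \<Rightarrow> 'w \<Rightarrow> real^'n) \<Rightarrow> (nat \<Rightarrow> 'w \<Rightarrow> real^'p) \<Rightarrow> bool" where
  "imperfect_model M A C V N x0 w v \<longleftrightarrow>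
     (\<forall>k\<le>N. pd_mat (V k) \<and> observable (A k) (C k))
     \<and> (\<forall>k\<le>N. gaussian_rv M (v k) 0 (V k))
     \<and> prob_space.indep_vars M (\<lambda>_. borel)
          (\<lambda>i. case i of X0 \<Rightarrow> (\<lambda>\<omega>. (x0 \<omega>, 0 :: real^'p))
                      | Wn k \<Rightarrow> (\<lambda>\<omega>. (w k \<omega>, 0 :: real^'p))
                      | Vn k \<Rightarrow> (\<lambda>\<omega>. (0 :: real^'n, v k \<omega>)))
          (insert X0 (Wn ` {..N} \<union> Vn ` {..N}))"

end

theory Submission
  imports Defs
begin

text \<open>Completing the square along the Riccati recursion shows that, for every trigger adapted to the
  information of the event trigger, the expected cost under \<open>u_k = - L_k xhat_k\<close> is a constant plus
  the expectation of \<open>\<Sum>k\<le>N. e_k' \<Gamma>_k e_k + \<theta>_k \<delta>_k\<close>; the cross terms vanish because \<open>w_k\<close> is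
  orthogonal to the past. Let \<open>\<pi>_j\<close> follow \<open>\<pi>\<^sup>+\<close> before time \<open>j\<close> and the periodic policy from \<open>j\<close> on.
  Then \<open>\<pi>_(j+1)\<close> and \<open>\<pi>_j\<close> differ only in the decision at time \<open>j\<close>, and \<open>VoI_j\<close> is exactly the
  conditional expectation, given the trigger's information, of the cost of deciding \<open>0\<close> minus the
  cost of deciding \<open>1\<close>. Hence thresholding \<open>VoI_j\<close> at \<open>0\<close> cannot increase the cost, and the
  comparisons telescope from the periodic policy to \<open>\<pi>\<^sup>+\<close>. No optimality of the Kalman gain is
  involved, so perfect information is the special case of noiseless observation of the whole state.\<close>

section \<open>Transposes, inverses and definite matrices\<close>

lemma inner_transpose_mult_vec:
  fixes A :: "real^'n^'m"
  shows "x \<bullet> (transpose A *v y) = (A *v x) \<bullet> y"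
  by (metis dot_lmul_matrix inner_commute transpose_matrix_vector)

lemma symmetric_inner_swap:
  fixes S :: "real^'n^'n"
  assumes "transpose S = S"
  shows "x \<bullet> (S *v y) = y \<bullet> (S *v x)"
  by (metis assms inner_transpose_mult_vec inner_commute)

lemma symmetric_quadratic_add:
  fixes S :: "real^'n^'n"
  assumes "transpose S = S"
  shows "(x + y) \<bullet> (S *v (x + y)) = x \<bullet> (S *v x) + 2 * (y \<bullet> (S *v x)) + y \<bullet> (S *v y)"
  using symmetric_inner_swap[OF assms, of x y]
  by (simp add: matrix_vector_right_distrib inner_add_left inner_add_right)

lemma matrix_inv_mult:
  fixes A :: "real^'n^'n"
  assumes "invertible A"
  shows "A ** matrix_inv A = mat 1" "matrix_inv A ** A = mat 1"
proof -
  obtain A' where "A ** A' = mat 1 \<and> A' ** A = mat 1"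
    using assms unfolding invertible_def by blast
  then have "A ** matrix_inv A = mat 1 \<and> matrix_inv A ** A = mat 1"
    unfolding matrix_inv_def by (rule someI)
  then show "A ** matrix_inv A = mat 1" "matrix_inv A ** A = mat 1" by auto
qed

lemma transpose_add: "transpose (A + B) = transpose A + transpose B"
  by (simp add: transpose_def vec_eq_iff)

lemma transpose_diff: "transpose (A - B) = transpose A - transpose (B :: real^'n^'m)"
  by (simp add: transpose_def vec_eq_iff)

text \<open>Definiteness forces a trivial kernel, and a square matrix with trivial kernel is
  invertible.\<close>

lemma pd_mat_invertible:
  assumes "pd_mat S"
  shows "invertible S"
proof -
  have "\<forall>x. S *v x = 0 \<longrightarrow> x = 0"
    using assms unfolding pd_mat_def by (metis inner_zero_right less_irrefl)
  then show ?thesis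
    using matrix_left_invertible_ker[of S] invertible_left_inverse[of S] by blast
qed

lemma pd_mat_imp_psd_mat: "pd_mat S \<Longrightarrow> psd_mat S"
  unfolding pd_mat_def psd_mat_def by (metis inner_zero_left less_eq_real_def)

lemma psd_mat_congruence:
  fixes S :: "real^'n^'n" and B :: "real^'m^'n"
  assumes "psd_mat S"
  shows "psd_mat (transpose B ** S ** B)"
  using assms unfolding psd_mat_def
  by (auto simp: matrix_transpose_mul matrix_mul_assoc inner_transpose_mult_vec
      simp flip: matrix_vector_mul_assoc simp del: transpose_matrix_vector)

lemma pd_mat_psd_add:
  assumes "psd_mat S" "pd_mat R"
  shows "pd_mat (S + R)"
  using assms unfolding psd_mat_def pd_mat_def
  by (auto simp: transpose_add matrix_vector_mult_add_rdistrib inner_add_right add_nonneg_pos)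

text \<open>One side is a right inverse and the other a left inverse of \<open>transpose A\<close>,
  so they coincide.\<close>

lemma transpose_matrix_inv:
  fixes A :: "real^'n^'n"
  assumes "invertible A"
  shows "transpose (matrix_inv A) = matrix_inv (transpose A)"
proof -
  have "transpose A ** transpose (matrix_inv A) = mat 1"
    using matrix_inv_mult(2)[OF assms] by (metis matrix_transpose_mul transpose_mat)
  moreover have "matrix_inv (transpose A) ** transpose A = mat 1"
    using assms by (intro matrix_inv_mult) (simp add: transpose_invertible)
  ultimately show ?thesis
    by (metis matrix_mul_assoc matrix_mul_lid matrix_mul_rid)
qed

section \<open>Riccati recursion\<close>

locale riccati =
  fixes A :: "nat \<Rightarrow> real^'n^'n" and B :: "nat \<Rightarrow> real^'m^'n"
    and Q :: "nat \<Rightarrow> real^'n^'n" and R :: "nat \<Rightarrow> real^'m^'m" and N :: nat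
  assumes Q_psd: "k \<le> Suc N \<Longrightarrow> psd_mat (Q k)"
    and R_pd: "k \<le> N \<Longrightarrow> pd_mat (R k)"
begin

abbreviation "S \<equiv> ricS A B Q R N"
abbreviation "L \<equiv> ricL A B Q R N"
abbreviation "\<Gamma> \<equiv> ricGamma A B Q R N"
abbreviation "G k \<equiv> transpose (B k) ** S (Suc k) ** B k + R k"

lemma S_end: "S (Suc N) = Q (Suc N)"
  by (simp add: ricS_def)

lemma S_rec:
  assumes "k \<le> N"
  shows "S k = Q k + transpose (A k) ** S (Suc k) ** A k - \<Gamma> k"
proof -
  \<comment> \<open>\<open>ric_back\<close> counts steps back from the horizon; these identities
    translate its reversed index into forward time.\<close>
  have "Suc N - k = Suc (N - k)" "N - (N - k) = k" "Suc N - Suc k = N - k"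
    using assms by auto
  then show ?thesis
    using assms by (simp add: ricS_def riccati_step_def ricGamma_def Let_def)
qed

text \<open>Semidefiniteness of \<open>S (Suc k)\<close> is carried as a hypothesis here and in the
  following lemmas, because the backward induction in \<open>S_psd\<close> relies on them.\<close>

lemma G_pd:
  assumes "k \<le> N" "psd_mat (S (Suc k))"
  shows "pd_mat (G k)"
  using assms R_pd by (intro pd_mat_psd_add psd_mat_congruence) auto

text \<open>These are the normal equations of minimising the one-step cost over the control; the
  inverse inside the gain cancels because \<open>G k\<close> is definite.\<close>

lemma G_L_vec:
  assumes "k \<le> N" "psd_mat (S (Suc k))"
  shows "G k *v (L k *v x) = transpose (B k) *v (S (Suc k) *v (A k *v x))"
proof -
  have "G k ** L k = G k ** matrix_inv (G k) ** transpose (B k) ** S (Suc k) ** A k"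
    by (simp add: ricL_def Let_def matrix_mul_assoc)
  also have "\<dots> = transpose (B k) ** S (Suc k) ** A k"
    using matrix_inv_mult(1)[OF pd_mat_invertible[OF G_pd[OF assms]]] by simp
  finally show ?thesis
    by (simp only: matrix_vector_mul_assoc matrix_mul_assoc)
qed

text \<open>\<open>\<Gamma> k\<close> is the congruence of \<open>G k\<close> by the gain: an
  estimation error is weighted as the control deviation that it causes.\<close>

lemma Gamma_inner:
  assumes "k \<le> N" "psd_mat (S (Suc k))"
  shows "x \<bullet> (\<Gamma> k *v y) = (L k *v x) \<bullet> (G k *v (L k *v y))"
proof -
  have sym: "transpose (S (Suc k)) = S (Suc k)" "transpose (G k) = G k"
    using assms(2) G_pd[OF assms] by (auto simp: psd_mat_def pd_mat_def)
  have "\<Gamma> k *v y = transpose (A k) *v (S (Suc k) *v (B k *v (L k *v y)))"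
    using assms(1) by (simp add: ricGamma_def ricL_def Let_def matrix_mul_assoc
        matrix_vector_mul_assoc del: transpose_matrix_vector)
  then have "x \<bullet> (\<Gamma> k *v y) = (A k *v x) \<bullet> (S (Suc k) *v (B k *v (L k *v y)))"
    by (simp add: inner_transpose_mult_vec del: transpose_matrix_vector)
  also have "\<dots> = (B k *v (L k *v y)) \<bullet> (S (Suc k) *v (A k *v x))"
    by (rule symmetric_inner_swap[OF sym(1)])
  also have "\<dots> = (L k *v y) \<bullet> (G k *v (L k *v x))"
    by (simp only: G_L_vec[OF assms] inner_transpose_mult_vec)
  also have "\<dots> = (L k *v x) \<bullet> (G k *v (L k *v y))"
    by (rule symmetric_inner_swap[OF sym(2)])
  finally show ?thesis .
qed

lemma Gamma_symmetric_step:
  assumes "k \<le> N" "psd_mat (S (Suc k))"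
  shows "transpose (\<Gamma> k) = \<Gamma> k"
proof -
  have inv: "transpose (matrix_inv (G k)) = matrix_inv (G k)"
    using transpose_matrix_inv[OF pd_mat_invertible[OF G_pd[OF assms]]] G_pd[OF assms]
    by (simp add: pd_mat_def)
  show ?thesis
    using assms inv by (simp add: ricGamma_def Let_def matrix_transpose_mul matrix_mul_assoc psd_mat_def)
qed

text \<open>One Bellman step: the minimiser over \<open>u\<close> is \<open>- (L k *v x)\<close>,
  and any other control pays the \<open>G k\<close>-square of its deviation from it.\<close>

lemma completion_of_squares_step:
  assumes "k \<le> N" "psd_mat (S (Suc k))"
  shows "x \<bullet> (Q k *v x) + u \<bullet> (R k *v u)
           + (A k *v x + B k *v u) \<bullet> (S (Suc k) *v (A k *v x + B k *v u))
         = x \<bullet> (S k *v x) + (u + L k *v x) \<bullet> (G k *v (u + L k *v x))"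
proof -
  have sym: "transpose (S (Suc k)) = S (Suc k)" "transpose (G k) = G k"
    using assms(2) G_pd[OF assms] by (auto simp: psd_mat_def pd_mat_def)
  have 1: "x \<bullet> (S k *v x) = x \<bullet> (Q k *v x) + (A k *v x) \<bullet> (S (Suc k) *v (A k *v x))
      - (L k *v x) \<bullet> (G k *v (L k *v x))"
    using Gamma_inner[OF assms, of x x]
    by (simp add: S_rec[OF assms(1)] matrix_vector_mult_add_rdistrib matrix_vector_mult_diff_rdistrib
        inner_add_right inner_diff_right inner_transpose_mult_vec
        flip: matrix_vector_mul_assoc del: transpose_matrix_vector)
  have 2: "u \<bullet> (G k *v u) = (B k *v u) \<bullet> (S (Suc k) *v (B k *v u)) + u \<bullet> (R k *v u)"
    by (simp add: matrix_vector_mult_add_rdistrib inner_add_right inner_transpose_mult_vec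
        flip: matrix_vector_mul_assoc del: transpose_matrix_vector)
  have 3: "u \<bullet> (G k *v (L k *v x)) = (B k *v u) \<bullet> (S (Suc k) *v (A k *v x))"
    by (simp only: G_L_vec[OF assms] inner_transpose_mult_vec)
  show ?thesis
    using 1 2 3 symmetric_quadratic_add[OF sym(1), of "A k *v x" "B k *v u"]
      symmetric_quadratic_add[OF sym(2), of u "L k *v x"]
      symmetric_inner_swap[OF sym(2), of u "L k *v x"]
    by argo
qed

lemma S_psd:
  assumes "k \<le> Suc N"
  shows "psd_mat (S k)"
  using assms
proof (induction k rule: inc_induct)
  case base
  then show ?case using Q_psd by (simp add: S_end)
next
  case (step k)
  then have k: "k \<le> N" "psd_mat (S (Suc k))" by auto
  have "transpose (S k) = S k"
    using k Q_psd[of k] psd_mat_congruence[OF k(2), of "A k"]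
    by (simp add: S_rec[OF k(1)] transpose_add transpose_diff Gamma_symmetric_step psd_mat_def)
  moreover have "0 \<le> x \<bullet> (S k *v x)" for x
  proof -
    \<comment> \<open>The minimising control makes the square vanish, so the quadratic form of
      \<open>S k\<close> becomes a sum of nonnegative costs.\<close>
    let ?u = "- (L k *v x)" and ?z = "A k *v x + B k *v (- (L k *v x))"
    have "x \<bullet> (S k *v x) = x \<bullet> (Q k *v x) + ?u \<bullet> (R k *v ?u) + ?z \<bullet> (S (Suc k) *v ?z)"
      using completion_of_squares_step[OF k, of x ?u] by simp
    moreover have "0 \<le> x \<bullet> (Q k *v x)" "0 \<le> ?u \<bullet> (R k *v ?u)" "0 \<le> ?z \<bullet> (S (Suc k) *v ?z)"
      using Q_psd[OF le_SucI[OF k(1)]] pd_mat_imp_psd_mat[OF R_pd[OF k(1)]] k(2)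
      unfolding psd_mat_def by blast+
    ultimately show ?thesis by linarith
  qed
  ultimately show ?case by (simp add: psd_mat_def)
qed

lemma Gamma_symmetric:
  assumes "k \<le> Suc N"
  shows "transpose (\<Gamma> k) = \<Gamma> k"
proof (cases "k = Suc N")
  case True
  then show ?thesis by (simp add: ricGamma_def transpose_def vec_eq_iff)
next
  case False
  then show ?thesis using assms by (intro Gamma_symmetric_step S_psd) auto
qed

lemma Gamma_end: "\<Gamma> (Suc N) = 0"
  by (simp add: ricGamma_def)

text \<open>Here \<open>z\<close> plays the role of the estimate \<open>xhat_k\<close> and \<open>w\<close> that of the process noise.\<close>

lemma stage_cost_identity:
  assumes "k \<le> N" and u: "u = - (L k *v z)"
  shows "x \<bullet> (Q k *v x) + u \<bullet> (R k *v u)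
           + (A k *v x + B k *v u + w) \<bullet> (S (Suc k) *v (A k *v x + B k *v u + w))
         = x \<bullet> (S k *v x) + (x - z) \<bullet> (\<Gamma> k *v (x - z))
           + 2 * (w \<bullet> (S (Suc k) *v (A k *v x + B k *v u))) + w \<bullet> (S (Suc k) *v w)"
proof -
  have S: "psd_mat (S (Suc k))" using assms(1) by (intro S_psd) simp
  then have sym: "transpose (S (Suc k)) = S (Suc k)" by (simp add: psd_mat_def)
  \<comment> \<open>Feeding back \<open>z\<close> instead of \<open>x\<close> misses the minimiser
    by the gain applied to the error; this turns the square into a
    \<open>\<Gamma> k\<close>-form.\<close>
  have "u + L k *v x = L k *v (x - z)"
    by (simp add: u matrix_vector_mult_diff_distrib)
  then have "(u + L k *v x) \<bullet> (G k *v (u + L k *v x)) = (x - z) \<bullet> (\<Gamma> k *v (x - z))"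
    by (simp only: Gamma_inner[OF assms(1) S])
  then show ?thesis
    using completion_of_squares_step[OF assms(1) S, of x u]
      symmetric_quadratic_add[OF sym, of "A k *v x + B k *v u" w] by linarith
qed

end

section \<open>Square-integrable random vectors\<close>

text \<open>The whole closed loop stays in this class: it is stable under sums, matrices and
  measurable case distinctions, and inner products of its members are integrable.\<close>

definition sq_integrable :: "'w measure \<Rightarrow> ('w \<Rightarrow> 'a::euclidean_space) \<Rightarrow> bool" where
  "sq_integrable M X \<longleftrightarrow> X \<in> borel_measurable M \<and> integrable M (\<lambda>\<omega>. (norm (X \<omega>))\<^sup>2)"

lemma sq_integrable_measurable: "sq_integrable M X \<Longrightarrow> X \<in> borel_measurable M"
  by (simp add: sq_integrable_def)

text \<open>The pointwise bound with one constant \<open>c\<close> replaces linearity, so that it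
  also covers multiplication by a random but bounded gain matrix.\<close>

lemma sq_integrable_bound:
  fixes X :: "'w \<Rightarrow> 'a::euclidean_space" and Y :: "'w \<Rightarrow> 'b::euclidean_space"
  assumes X: "sq_integrable M X" and Y: "Y \<in> borel_measurable M"
    and le: "\<And>\<omega>. norm (Y \<omega>) \<le> c * norm (X \<omega>)"
  shows "sq_integrable M Y"
  unfolding sq_integrable_def
proof (intro conjI Y, rule Bochner_Integration.integrable_bound)
  show "integrable M (\<lambda>\<omega>. c\<^sup>2 * (norm (X \<omega>))\<^sup>2)"
    using X by (simp add: sq_integrable_def)
  show "(\<lambda>\<omega>. (norm (Y \<omega>))\<^sup>2) \<in> borel_measurable M"
    using Y by measurable
  show "AE \<omega> in M. norm ((norm (Y \<omega>))\<^sup>2) \<le> norm (c\<^sup>2 * (norm (X \<omega>))\<^sup>2)"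
    using power_mono[OF le norm_ge_zero, of _ 2] by (simp add: power_mult_distrib)
qed

lemma sq_integrable_add:
  assumes "sq_integrable M X" "sq_integrable M Y"
  shows "sq_integrable M (\<lambda>\<omega>. X \<omega> + Y \<omega>)"
  unfolding sq_integrable_def
proof (intro conjI, goal_cases)
  case 1
  show ?case using assms by (auto simp: sq_integrable_def)
next
  case 2
  have le: "(norm (x + y))\<^sup>2 \<le> 2 * (norm x)\<^sup>2 + 2 * (norm y)\<^sup>2" for x y :: 'b
  proof -
    have "(norm (x + y))\<^sup>2 \<le> (norm x + norm y)\<^sup>2"
      by (intro power_mono norm_triangle_ineq) simp
    also have "\<dots> \<le> 2 * (norm x)\<^sup>2 + 2 * (norm y)\<^sup>2"
      using sum_squares_bound[of "norm x" "norm y"] by (simp add: power2_sum)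
    finally show ?thesis .
  qed
  show ?case
  proof (rule Bochner_Integration.integrable_bound)
    show "integrable M (\<lambda>\<omega>. 2 * (norm (X \<omega>))\<^sup>2 + 2 * (norm (Y \<omega>))\<^sup>2)"
      using assms by (simp add: sq_integrable_def)
    show "(\<lambda>\<omega>. (norm (X \<omega> + Y \<omega>))\<^sup>2) \<in> borel_measurable M"
      using assms by (auto simp: sq_integrable_def)
  qed (use le in \<open>simp add: add_nonneg_nonneg\<close>)
qed

lemma measurable_matrix_vector_mult [measurable (raw)]:
  fixes A :: "real^'n^'m"
  assumes "X \<in> borel_measurable M"
  shows "(\<lambda>\<omega>. A *v X \<omega>) \<in> borel_measurable M"
  using borel_measurable_continuous_onI[OF matrix_vector_mult_linear_continuous_on[of UNIV A]] assms
  by measurable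

lemma sq_integrable_matrix_vector:
  fixes A :: "real^'n^'m"
  assumes "sq_integrable M X"
  shows "sq_integrable M (\<lambda>\<omega>. A *v X \<omega>)"
  using assms
proof (rule sq_integrable_bound[where c = "onorm ((*v) A)"])
  show "(\<lambda>\<omega>. A *v X \<omega>) \<in> borel_measurable M"
    using assms by (auto simp: sq_integrable_def)
qed (simp add: onorm)

lemma sq_integrable_uminus: "sq_integrable M X \<Longrightarrow> sq_integrable M (\<lambda>\<omega>. - X \<omega>)"
  by (simp add: sq_integrable_def)

lemma sq_integrable_diff:
  "sq_integrable M X \<Longrightarrow> sq_integrable M Y \<Longrightarrow> sq_integrable M (\<lambda>\<omega>. X \<omega> - Y \<omega>)"
  using sq_integrable_add[of M X "\<lambda>\<omega>. - Y \<omega>"] sq_integrable_uminus by fastforce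

lemma (in finite_measure) sq_integrable_const: "sq_integrable M (\<lambda>_. c)"
  by (simp add: sq_integrable_def)

lemma sq_integrable_inner_integrable:
  assumes "sq_integrable M X" "sq_integrable M Y"
  shows "integrable M (\<lambda>\<omega>. X \<omega> \<bullet> Y \<omega>)"
proof (rule Bochner_Integration.integrable_bound)
  show "integrable M (\<lambda>\<omega>. (norm (X \<omega>))\<^sup>2 + (norm (Y \<omega>))\<^sup>2)"
    using assms by (simp add: sq_integrable_def)
  show "(\<lambda>\<omega>. X \<omega> \<bullet> Y \<omega>) \<in> borel_measurable M"
    using assms by (auto simp: sq_integrable_def)
  have "\<bar>x \<bullet> y\<bar> \<le> (norm x)\<^sup>2 + (norm y)\<^sup>2" for x y :: 'b
    using Cauchy_Schwarz_ineq2[of x y] sum_squares_bound[of "norm x" "norm y"]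
      mult_nonneg_nonneg[OF norm_ge_zero[of x] norm_ge_zero[of y]] by linarith
  then show "AE \<omega> in M. norm (X \<omega> \<bullet> Y \<omega>) \<le> norm ((norm (X \<omega>))\<^sup>2 + (norm (Y \<omega>))\<^sup>2)"
    by (simp add: add_nonneg_nonneg)
qed

lemma sq_integrable_component:
  fixes X :: "'w \<Rightarrow> real^'n"
  assumes "sq_integrable M X"
  shows "sq_integrable M (\<lambda>\<omega>. X \<omega> $ i)"
  using assms
proof (rule sq_integrable_bound[where c = 1])
  have "(\<lambda>\<omega>. axis i 1 \<bullet> X \<omega>) \<in> borel_measurable M"
    using assms by (auto simp: sq_integrable_def)
  then show "(\<lambda>\<omega>. X \<omega> $ i) \<in> borel_measurable M"
    by (simp add: inner_axis')
qed (simp add: component_le_norm_cart)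

lemma sq_integrable_if:
  assumes "sq_integrable M X" "sq_integrable M Y" and [measurable]: "Measurable.pred M P"
  shows "sq_integrable M (\<lambda>\<omega>. if P \<omega> then X \<omega> else Y \<omega>)"
  unfolding sq_integrable_def
proof (intro conjI, goal_cases)
  have [measurable]: "X \<in> borel_measurable M" "Y \<in> borel_measurable M"
    using assms by (auto simp: sq_integrable_def)
  case 1
  show ?case by measurable
  case 2
  show ?case
  proof (rule Bochner_Integration.integrable_bound)
    show "integrable M (\<lambda>\<omega>. (norm (X \<omega>))\<^sup>2 + (norm (Y \<omega>))\<^sup>2)"
      using assms by (simp add: sq_integrable_def)
  qed (auto simp: add_nonneg_nonneg)
qed

section \<open>Gaussian noise\<close>

text \<open>The law is prescribed through linear functionals, so moments are read off direction by
  direction: constant almost surely in a degenerate direction, a normal density otherwise.\<close>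

lemma (in prob_space) gaussian_rv_moments:
  assumes X: "gaussian_rv M X m \<Sigma>" and \<Sigma>: "psd_mat \<Sigma>"
  shows "integrable M (\<lambda>\<omega>. a \<bullet> X \<omega>)" "(\<integral>\<omega>. a \<bullet> X \<omega> \<partial>M) = a \<bullet> m"
    "integrable M (\<lambda>\<omega>. (a \<bullet> X \<omega>)\<^sup>2)"
proof -
  have [measurable]: "X \<in> borel_measurable M" using X by (simp add: gaussian_rv_def)
  have "integrable M (\<lambda>\<omega>. a \<bullet> X \<omega>) \<and> (\<integral>\<omega>. a \<bullet> X \<omega> \<partial>M) = a \<bullet> m \<and>
    integrable M (\<lambda>\<omega>. (a \<bullet> X \<omega>)\<^sup>2)"
  proof (cases "a \<bullet> (\<Sigma> *v a) = 0")
    case True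
    then have ae: "AE \<omega> in M. a \<bullet> X \<omega> = a \<bullet> m"
      using X unfolding gaussian_rv_def by (metis (no_types, lifting))
    have "integrable M (\<lambda>\<omega>. a \<bullet> X \<omega>) \<longleftrightarrow> integrable M (\<lambda>\<omega>. a \<bullet> m)"
      using ae by (intro integrable_cong_AE) auto
    moreover have "integrable M (\<lambda>\<omega>. (a \<bullet> X \<omega>)\<^sup>2) \<longleftrightarrow> integrable M (\<lambda>\<omega>. (a \<bullet> m)\<^sup>2)"
      using ae by (intro integrable_cong_AE) auto
    moreover have "(\<integral>\<omega>. a \<bullet> X \<omega> \<partial>M) = (\<integral>\<omega>. a \<bullet> m \<partial>M)"
      using ae by (intro integral_cong_AE) auto
    ultimately show ?thesis by (simp add: prob_space)
  next
    case False
    define s where "s = sqrt (a \<bullet> (\<Sigma> *v a))"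
    have s: "0 < s" using False \<Sigma> unfolding s_def psd_mat_def by (simp add: less_le)
    have D: "distributed M lborel (\<lambda>\<omega>. a \<bullet> X \<omega>) (normal_density (a \<bullet> m) s)"
      using X False unfolding gaussian_rv_def s_def by (metis (no_types, lifting))
    have 1: "integrable M (\<lambda>\<omega>. a \<bullet> X \<omega>)"
      using distributed_integrable_var[OF D] integrable_normal_moment_nz_1[OF s] by simp
    have "integrable M (\<lambda>\<omega>. (a \<bullet> X \<omega> - a \<bullet> m)\<^sup>2)"
      using distributed_integrable[OF D, of "\<lambda>x. (x - a \<bullet> m)\<^sup>2"] integrable_normal_moment[OF s, of _ 2]
      by simp
    \<comment> \<open>The raw second moment, written as the central one plus an affine function of
      the integrable first-order term.\<close>
    then have "integrable M (\<lambda>\<omega>. (a \<bullet> X \<omega> - a \<bullet> m)\<^sup>2 + 2 * (a \<bullet> m) * (a \<bullet> X \<omega>) - (a \<bullet> m)\<^sup>2)"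
      using 1 by auto
    then have "integrable M (\<lambda>\<omega>. (a \<bullet> X \<omega>)\<^sup>2)"
      by (simp add: power2_diff algebra_simps)
    then show ?thesis
      using 1 normal_distributed_expectation[OF s D] by simp
  qed
  then show "integrable M (\<lambda>\<omega>. a \<bullet> X \<omega>)" "(\<integral>\<omega>. a \<bullet> X \<omega> \<partial>M) = a \<bullet> m"
    "integrable M (\<lambda>\<omega>. (a \<bullet> X \<omega>)\<^sup>2)" by auto
qed

lemma (in prob_space) gaussian_rv_sq_integrable:
  fixes X :: "'a \<Rightarrow> real^'n"
  assumes "gaussian_rv M X m \<Sigma>" "psd_mat \<Sigma>"
  shows "sq_integrable M X"
proof -
  have "(norm x)\<^sup>2 = (\<Sum>i\<in>UNIV. (axis i 1 \<bullet> x)\<^sup>2)" for x :: "real^'n"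
    unfolding power2_norm_eq_inner inner_vec_def[of x x]
    by (simp add: power2_eq_square inner_axis')
  then show ?thesis
    using assms gaussian_rv_moments(3)[OF assms]
    by (simp add: sq_integrable_def gaussian_rv_def)
qed

section \<open>Information generated by a family of random vectors\<close>

text \<open>Common shape of the trigger's information and of the past of the primitive noise, so
  that both share the facts below.\<close>

definition generated_info :: "'w measure \<Rightarrow> ('i \<Rightarrow> 'w \<Rightarrow> 'b::topological_space) \<Rightarrow> 'i set \<Rightarrow> 'w measure"
  where "generated_info M X J =
    sigma (space M) (\<Union>i\<in>J. {X i -` T \<inter> space M | T. T \<in> sets borel})"

lemma space_generated_info: "space (generated_info M X J) = space M"
  unfolding generated_info_def by (auto intro!: space_measure_of)

lemma sets_generated_info:
  "sets (generated_info M X J) =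
    sigma_sets (space M) (\<Union>i\<in>J. {X i -` T \<inter> space M | T. T \<in> sets borel})"
  unfolding generated_info_def by (auto intro!: sets_measure_of)

lemma measurable_generated_info:
  assumes "i \<in> J"
  shows "X i \<in> borel_measurable (generated_info M X J)"
  using assms
  by (intro measurableI) (auto simp: space_generated_info sets_generated_info intro!: sigma_sets.Basic)

text \<open>Minimality reduces every comparison of information to measurability of the generating
  vectors.\<close>

lemma generated_info_least:
  assumes "space H = space M" "\<And>i. i \<in> J \<Longrightarrow> X i \<in> borel_measurable H"
  shows "subalgebra H (generated_info M X J)"
proof -
  have "(\<Union>i\<in>J. {X i -` T \<inter> space M | T. T \<in> sets borel}) \<subseteq> sets H"
    using assms(2) unfolding assms(1)[symmetric] by (auto intro: measurable_sets)
  then show ?thesis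
    unfolding subalgebra_def space_generated_info sets_generated_info assms(1)[symmetric]
    by (simp add: sets.sigma_sets_subset)
qed

text \<open>Independence survives grouping the family into disjoint blocks, so a function of block
  \<open>J\<close> is independent of a function of \<open>X j\<close> and the expectation
  factors.\<close>

lemma (in prob_space) indep_generated_info_integral:
  fixes h :: "'a \<Rightarrow> real" and X :: "'i \<Rightarrow> 'a \<Rightarrow> 'b::topological_space"
  assumes indep: "indep_vars (\<lambda>_. borel) X I" and j: "j \<in> I" "j \<notin> J" and J: "J \<subseteq> I"
    and h: "h \<in> borel_measurable (generated_info M X J)" "integrable M h"
    and g: "g \<in> borel_measurable borel" "integrable M (\<lambda>\<omega>. g (X j \<omega>))"
  shows "(\<integral>\<omega>. h \<omega> * g (X j \<omega>) \<partial>M) = (\<integral>\<omega>. h \<omega> \<partial>M) * (\<integral>\<omega>. g (X j \<omega>) \<partial>M)"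
proof (rule indep_var_lebesgue_integral[OF _ h(2) g(2)])
  let ?E = "\<lambda>i. {X i -` T \<inter> space M | T. T \<in> sets borel}"
  \<comment> \<open>The two blocks are indexed by \<open>bool\<close>, the form in which
    \<open>indep_set\<close> expresses independence of a pair.\<close>
  let ?I = "\<lambda>b. if b then J else {j}"
  have X: "X i \<in> borel_measurable M" if "i \<in> I" for i
    using indep that by (auto simp: indep_vars_def2)
  have "indep_sets ?E I" using indep by (simp add: indep_vars_def2)
  then have "indep_sets ?E (\<Union>b\<in>UNIV. ?I b)"
    by (rule indep_sets_mono_index[rotated]) (use j J in auto)
  moreover have "Int_stable (?E i)" for i
    unfolding Int_stable_def
  proof safe
    fix T T' :: "'b set" assume "T \<in> sets borel" "T' \<in> sets borel"
    then show "\<exists>U. X i -` T \<inter> space M \<inter> (X i -` T' \<inter> space M) = X i -` U \<inter> space M \<and> U \<in> sets borel"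
      by (intro exI[of _ "T \<inter> T'"]) auto
  qed
  moreover have "disjoint_family_on ?I UNIV"
    using j by (auto simp: disjoint_family_on_def)
  ultimately have "indep_sets (\<lambda>b. sigma_sets (space M) (\<Union>i\<in>?I b. ?E i)) UNIV"
    by (rule indep_sets_collect_sigma)
  then have "indep_set (sigma_sets (space M) {h -` T \<inter> space M | T. T \<in> sets borel})
     (sigma_sets (space M) {(\<lambda>\<omega>. g (X j \<omega>)) -` T \<inter> space M | T. T \<in> sets borel})"
    unfolding indep_set_def
  proof (rule indep_sets_mono_sets)
    fix b :: bool
    show "(case b of True \<Rightarrow> sigma_sets (space M) {h -` T \<inter> space M | T. T \<in> sets borel}
        | False \<Rightarrow> sigma_sets (space M) {(\<lambda>\<omega>. g (X j \<omega>)) -` T \<inter> space M | T. T \<in> sets borel})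
      \<subseteq> sigma_sets (space M) (\<Union>i\<in>?I b. ?E i)"
    proof (cases b)
      case True
      have "{h -` T \<inter> space M | T. T \<in> sets borel} \<subseteq> sigma_sets (space M) (\<Union>i\<in>J. ?E i)"
        using measurable_sets[OF h(1)] by (auto simp: space_generated_info sets_generated_info)
      then show ?thesis
        using True by (auto intro: sigma_sets_mono[THEN subsetD])
    next
      case False
      have "{(\<lambda>\<omega>. g (X j \<omega>)) -` T \<inter> space M | T. T \<in> sets borel} \<subseteq> ?E j"
      proof safe
        fix T :: "real set" assume "T \<in> sets borel"
        then have "g -` T \<in> sets borel" using measurable_sets[OF g(1)] by simp
        moreover have "(\<lambda>\<omega>. g (X j \<omega>)) -` T \<inter> space M = X j -` (g -` T) \<inter> space M" by auto
        ultimately show "\<exists>U. (\<lambda>\<omega>. g (X j \<omega>)) -` T \<inter> space M = X j -` U \<inter> space M \<and> U \<in> sets borel"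
          by blast
      qed
      then show ?thesis
        using False sigma_sets_mono'[of _ "?E j"] by simp
    qed
  qed
  moreover have "h \<in> borel_measurable M" using h(2) by simp
  moreover have "(\<lambda>\<omega>. g (X j \<omega>)) \<in> borel_measurable M" using g(2) by simp
  ultimately show "indep_var borel h borel (\<lambda>\<omega>. g (X j \<omega>))"
    unfolding indep_var_eq by simp
qed

text \<open>The averaging property of conditional expectation, applied coordinate by coordinate. It
  later exchanges the state for its filtered version against vectors known to the trigger.\<close>

lemma (in sigma_finite_subalgebra) inner_cond_exp_integral:
  fixes X h \<xi> :: "'a \<Rightarrow> real^'n"
  assumes h: "h \<in> borel_measurable F" "sq_integrable M h" and X: "sq_integrable M X"
    and \<xi>: "\<xi> \<in> borel_measurable M" "\<And>i. AE \<omega> in M. \<xi> \<omega> $ i = real_cond_exp M F (\<lambda>\<omega>. X \<omega> $ i) \<omega>"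
  shows "integrable M (\<lambda>\<omega>. h \<omega> \<bullet> \<xi> \<omega>)" "(\<integral>\<omega>. h \<omega> \<bullet> \<xi> \<omega> \<partial>M) = (\<integral>\<omega>. h \<omega> \<bullet> X \<omega> \<partial>M)"
proof -
  let ?E = "\<lambda>i. real_cond_exp M F (\<lambda>\<omega>. X \<omega> $ i)"
  have hi: "(\<lambda>\<omega>. h \<omega> $ i) \<in> borel_measurable F" for i
  proof -
    have "(\<lambda>\<omega>. axis i 1 \<bullet> h \<omega>) \<in> borel_measurable F" using h(1) by measurable
    then show ?thesis by (simp add: inner_axis')
  qed
  have [measurable]: "h \<in> borel_measurable M" by (rule sq_integrable_measurable[OF h(2)])
  have hX: "integrable M (\<lambda>\<omega>. h \<omega> $ i * X \<omega> $ i)" for i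
    using sq_integrable_inner_integrable[OF sq_integrable_component[OF h(2)] sq_integrable_component[OF X]]
    by simp
  have Xi: "(\<lambda>\<omega>. X \<omega> $ i) \<in> borel_measurable M" for i
    by (rule sq_integrable_measurable[OF sq_integrable_component[OF X]])
  note ce = real_cond_exp_intg[OF hX hi Xi]
  have ae: "AE \<omega> in M. (\<Sum>i\<in>UNIV. h \<omega> $ i * ?E i \<omega>) = h \<omega> \<bullet> \<xi> \<omega>"
  proof -
    \<comment> \<open>There are finitely many coordinates, so the exceptional null sets combine into
      one.\<close>
    have "AE \<omega> in M. \<forall>i\<in>UNIV. \<xi> \<omega> $ i = ?E i \<omega>"
      using \<xi>(2) by (intro AE_finite_allI) auto
    then show ?thesis by eventually_elim (simp add: inner_vec_def)
  qed
  have int: "integrable M (\<lambda>\<omega>. \<Sum>i\<in>UNIV. h \<omega> $ i * ?E i \<omega>)"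
    using ce(1) by (intro Bochner_Integration.integrable_sum)
  show "integrable M (\<lambda>\<omega>. h \<omega> \<bullet> \<xi> \<omega>)"
    using int ae \<xi>(1) by (subst integrable_cong_AE[symmetric]) auto
  have "(\<integral>\<omega>. h \<omega> \<bullet> \<xi> \<omega> \<partial>M) = (\<integral>\<omega>. (\<Sum>i\<in>UNIV. h \<omega> $ i * ?E i \<omega>) \<partial>M)"
    using int ae \<xi>(1) by (intro integral_cong_AE) auto
  also have "\<dots> = (\<Sum>i\<in>UNIV. (\<integral>\<omega>. h \<omega> $ i * X \<omega> $ i \<partial>M))"
    using ce by (simp add: Bochner_Integration.integral_sum)
  also have "\<dots> = (\<integral>\<omega>. h \<omega> \<bullet> X \<omega> \<partial>M)"
    using hX by (simp add: inner_vec_def Bochner_Integration.integral_sum)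
  finally show "(\<integral>\<omega>. h \<omega> \<bullet> \<xi> \<omega> \<partial>M) = (\<integral>\<omega>. h \<omega> \<bullet> X \<omega> \<partial>M)" .
qed

section \<open>Triggered linear-quadratic control\<close>

text \<open>\<open>H k\<close> is the information carried by the primitive randomness up to time \<open>k\<close>. Of the stochastic
  assumptions, only square integrability and the orthogonality of \<open>w k\<close> to \<open>H k\<close> matter; in
  particular \<open>V k\<close> may be singular, so that perfect observation is covered as well.\<close>

locale triggered_lq = prob_space M + riccati A B Q R N
  for M :: "'w measure" and A :: "nat \<Rightarrow> real^'n^'n" and B :: "nat \<Rightarrow> real^'m^'n"
    and Q :: "nat \<Rightarrow> real^'n^'n" and R :: "nat \<Rightarrow> real^'m^'m" and N :: nat +
  fixes C :: "nat \<Rightarrow> real^'n^'p" and W :: "nat \<Rightarrow> real^'n^'n" and V :: "nat \<Rightarrow> real^'p^'p"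
    and th :: "nat \<Rightarrow> real" and m0 :: "real^'n" and M0 :: "real^'n^'n"
    and x0 :: "'w \<Rightarrow> real^'n" and w :: "nat \<Rightarrow> 'w \<Rightarrow> real^'n" and v :: "nat \<Rightarrow> 'w \<Rightarrow> real^'p"
    and H :: "nat \<Rightarrow> 'w measure"
  assumes th_nonneg: "k \<le> N \<Longrightarrow> 0 \<le> th k"
    and x0_sq: "sq_integrable M x0"
    and w_sq: "k \<le> N \<Longrightarrow> sq_integrable M (w k)"
    and v_sq: "k \<le> N \<Longrightarrow> sq_integrable M (v k)"
    and space_H: "k \<le> N \<Longrightarrow> space (H k) = space M"
    and x0_H: "k \<le> N \<Longrightarrow> x0 \<in> borel_measurable (H k)"
    and w_H: "k \<le> N \<Longrightarrow> t < k \<Longrightarrow> w t \<in> borel_measurable (H k)"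
    and v_H: "k \<le> N \<Longrightarrow> t \<le> k \<Longrightarrow> v t \<in> borel_measurable (H k)"
    and w_orth: "k \<le> N \<Longrightarrow> h \<in> borel_measurable (H k) \<Longrightarrow> sq_integrable M h \<Longrightarrow>
      (\<integral>\<omega>. h \<omega> * (a \<bullet> w k \<omega>) \<partial>M) = 0"
begin

section \<open>Closed loop, information and adapted triggers\<close>

abbreviation "st d k \<omega> \<equiv> icl A B C W V L m0 M0 x0 w v d k \<omega>"
abbreviation "xs d k \<omega> \<equiv> fst (st d k \<omega>)"
abbreviation "xh d k \<omega> \<equiv> fst (snd (st d k \<omega>))"
abbreviation "cov d k \<omega> \<equiv> snd (snd (st d k \<omega>))"
abbreviation "err d k \<omega> \<equiv> xs d k \<omega> - xh d k \<omega>"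
abbreviation "y d k \<omega> \<equiv> C k *v xs d k \<omega> + v k \<omega>"
abbreviation "info d k \<equiv> iinfo M A B C W V L m0 M0 x0 w v d k"
abbreviation "corr d k \<omega> \<equiv> kgain A C V k (cov d k \<omega>) *v (y d k \<omega> - C k *v xh d k \<omega>)"

lemma xs_Suc: "xs d (Suc k) \<omega> = A k *v xs d k \<omega> + B k *v (- (L k *v xh d k \<omega>)) + w k \<omega>"
  by (simp add: Let_def split_beta)

lemma xh_Suc: "xh d (Suc k) \<omega> = A k *v xh d k \<omega> + B k *v (- (L k *v xh d k \<omega>))
    + (if d k \<omega> then corr d k \<omega> else 0)"
  by (simp add: Let_def split_beta)

text \<open>The control enters state and estimate alike and cancels, so the new error is driven only
  by noise and correction.\<close>

lemma err_Suc: "err d (Suc k) \<omega> = A k *v err d k \<omega> + w k \<omega> - (if d k \<omega> then corr d k \<omega> else 0)"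
  unfolding xs_Suc xh_Suc by (simp add: matrix_vector_mult_diff_distrib)

text \<open>The form shows that, given the decision, the next covariance is a deterministic function
  of the present one.\<close>

lemma cov_Suc: "cov d (Suc k) \<omega> = (\<lambda>b P. A k ** P ** transpose (A k) + W k
    - (if b then kgain A C V k P ** C k ** P ** transpose (A k) else 0)) (d k \<omega>) (cov d k \<omega>)"
  by (simp add: Let_def split_beta)

declare icl.simps(2) [simp del]

text \<open>The decision at time \<open>k\<close> first acts on the estimate at
  \<open>Suc k\<close>, owing to the one-step delay, so agreement strictly before \<open>k\<close>
  is enough. The equality is pathwise.\<close>

lemma st_cong:
  assumes "\<And>t. t < k \<Longrightarrow> d t \<omega> = d' t \<omega>"
  shows "st d k \<omega> = st d' k \<omega>"
  using assms
proof (induction k)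
  case (Suc k)
  then have "st d k \<omega> = st d' k \<omega>" "d k \<omega> = d' k \<omega>" by auto
  then show ?case by (simp add: icl.simps(2))
qed simp

lemma info_eq: "info d k = generated_info M (y d) {..k}"
  by (simp add: iinfo_def generated_info_def)

lemma space_info [simp]: "space (info d k) = space M"
  by (simp add: info_eq space_generated_info)

lemma y_info:
  assumes "t \<le> k"
  shows "y d t \<in> borel_measurable (info d k)"
  using measurable_generated_info[of t "{..k}" "y d" M] assms by (simp add: info_eq)

lemma info_least:
  assumes "space G' = space M" "\<And>t. t \<le> k \<Longrightarrow> y d t \<in> borel_measurable G'"
  shows "subalgebra G' (info d k)"
  unfolding info_eq using assms by (intro generated_info_least) auto

lemma info_mono: "t \<le> k \<Longrightarrow> subalgebra (info d k) (info d t)"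
  by (intro info_least y_info) auto

text \<open>At a fixed time the covariance takes finitely many values, one per pattern of past
  decisions. Generalising over \<open>F\<close> absorbs one decision at each induction step, and
  matrix inversion in the gain is only ever evaluated at fixed matrices.\<close>

lemma cov_measurable:
  fixes F :: "real^'n^'n \<Rightarrow> 'w \<Rightarrow> 'b::topological_space"
  assumes "\<And>t. t < k \<Longrightarrow> Measurable.pred G' (d t)" "\<And>P. F P \<in> borel_measurable G'"
  shows "(\<lambda>\<omega>. F (cov d k \<omega>) \<omega>) \<in> borel_measurable G'"
  using assms
proof (induction k arbitrary: F)
  case (Suc k)
  define f where "f b P = A k ** P ** transpose (A k) + W k
    - (if b then kgain A C V k P ** C k ** P ** transpose (A k) else 0)" for b P
  have [measurable]: "Measurable.pred G' (d k)" using Suc.prems by simp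
  have [measurable]: "(\<lambda>\<omega>. F (f b (cov d k \<omega>)) \<omega>) \<in> borel_measurable G'" for b
    using Suc.IH[of "\<lambda>P. F (f b P)"] Suc.prems by auto
  have "(\<lambda>\<omega>. F (cov d (Suc k) \<omega>) \<omega>) =
      (\<lambda>\<omega>. if d k \<omega> then F (f True (cov d k \<omega>)) \<omega> else F (f False (cov d k \<omega>)) \<omega>)"
    by (simp add: fun_eq_iff cov_Suc f_def)
  then show ?case by simp
qed simp

text \<open>The same finiteness bounds any real function of the covariance; its use is for the
  operator norm of the gain.\<close>

lemma cov_bounded: "\<exists>c. \<forall>\<omega>. g (cov d k \<omega>) \<le> (c::real)"
proof (induction k arbitrary: g)
  case 0
  show ?case by auto
next
  case (Suc k)
  define f where "f b P = A k ** P ** transpose (A k) + W k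
    - (if b then kgain A C V k P ** C k ** P ** transpose (A k) else 0)" for b P
  obtain c1 where c1: "\<And>\<omega>. g (f True (cov d k \<omega>)) \<le> c1" using Suc[of "\<lambda>P. g (f True P)"] by auto
  obtain c2 where c2: "\<And>\<omega>. g (f False (cov d k \<omega>)) \<le> c2" using Suc[of "\<lambda>P. g (f False P)"] by auto
  have "g (cov d (Suc k) \<omega>) \<le> max c1 c2" for \<omega>
    using c1[of \<omega>] c2[of \<omega>] by (cases "d k \<omega>") (auto simp: cov_Suc f_def)
  then show ?case by blast
qed

lemma corr_measurable:
  assumes "\<And>t. t < k \<Longrightarrow> Measurable.pred G' (d t)"
    and [measurable]: "y d k \<in> borel_measurable G'" "xh d k \<in> borel_measurable G'"
  shows "corr d k \<in> borel_measurable G'"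
  using assms(1) by (rule cov_measurable) simp_all

lemma xh_measurable:
  assumes "\<And>t. t < k \<Longrightarrow> Measurable.pred G' (d t)" "\<And>t. t < k \<Longrightarrow> y d t \<in> borel_measurable G'"
  shows "xh d k \<in> borel_measurable G'"
  using assms
proof (induction k)
  case (Suc k)
  then have [measurable]: "xh d k \<in> borel_measurable G'" "Measurable.pred G' (d k)" by auto
  have [measurable]: "corr d k \<in> borel_measurable G'"
    using Suc.prems by (intro corr_measurable) auto
  show ?case unfolding xh_Suc by measurable
qed simp

text \<open>Strong induction is used because the estimate fed back at the last step depends on all
  earlier observations, hence on all earlier states.\<close>

lemma xs_measurable:
  assumes "\<And>t. t < k \<Longrightarrow> Measurable.pred G' (d t)" "x0 \<in> borel_measurable G'"
    "\<And>t. t < k \<Longrightarrow> w t \<in> borel_measurable G'" "\<And>t. t < k \<Longrightarrow> v t \<in> borel_measurable G'"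
  shows "xs d k \<in> borel_measurable G'"
  using assms
proof (induction k rule: less_induct)
  case (less k)
  show ?case
  proof (cases k)
    case (Suc j)
    have "y d t \<in> borel_measurable G'" if "t < k" for t
      using less.IH[OF that] less.prems that by simp
    then have [measurable]: "xh d j \<in> borel_measurable G'"
      using less.prems(1) Suc by (intro xh_measurable) auto
    have [measurable]: "xs d j \<in> borel_measurable G'" "w j \<in> borel_measurable G'"
      using less.IH[of j] less.prems Suc by auto
    show ?thesis unfolding Suc xs_Suc by measurable
  qed (use less.prems in simp)
qed

text \<open>The information is the one generated under \<open>d\<close> itself, since the control
  feeds earlier decisions back into the observations.\<close>

definition adapted :: "(nat \<Rightarrow> 'w \<Rightarrow> bool) \<Rightarrow> bool" where
  "adapted d \<longleftrightarrow> (\<forall>k\<le>N. Measurable.pred (info d k) (d k))"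

lemma adapted_const: "adapted (\<lambda>k _. b k)"
  by (simp add: adapted_def)

lemma xh_info:
  assumes "\<And>t. t < k \<Longrightarrow> Measurable.pred (info d t) (d t)"
  shows "xh d k \<in> borel_measurable (info d k)" "corr d k \<in> borel_measurable (info d k)"
proof -
  have d: "Measurable.pred (info d k) (d t)" if "t < k" for t
    using measurable_from_subalg[OF info_mono assms[OF that]] that by simp
  show xh: "xh d k \<in> borel_measurable (info d k)"
    using d by (intro xh_measurable y_info) auto
  show "corr d k \<in> borel_measurable (info d k)"
    using d by (intro corr_measurable y_info xh) auto
qed

text \<open>Observations up to \<open>t\<close> make the decision at \<open>t\<close> measurable for
  \<open>H k\<close>, and earlier decisions and noise make the next observation so; strong induction
  on time resolves this interlocking.\<close>

lemma adapted_past: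
  assumes d: "adapted d" and k: "k \<le> N"
  shows "xs d k \<in> borel_measurable (H k)" "xh d k \<in> borel_measurable (H k)"
    and "subalgebra (H k) (info d k)"
proof -
  have dt: "Measurable.pred (H k) (d t)"
    if "t \<le> k" "\<And>s. s \<le> t \<Longrightarrow> y d s \<in> borel_measurable (H k)" for t
  proof (rule measurable_from_subalg[OF info_least])
    show "Measurable.pred (info d t) (d t)" using d that k by (simp add: adapted_def)
  qed (use that k space_H in auto)
  have step: "xs d t \<in> borel_measurable (H k)"
    if "t \<le> k" "\<And>s. s < t \<Longrightarrow> y d s \<in> borel_measurable (H k)" for t
    using that k by (intro xs_measurable dt x0_H w_H v_H) auto
  have y: "y d t \<in> borel_measurable (H k)" if "t \<le> k" for t
    using that
  proof (induction t rule: less_induct)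
    case (less t)
    have [measurable]: "xs d t \<in> borel_measurable (H k)" "v t \<in> borel_measurable (H k)"
      using less k by (auto intro!: step v_H)
    show ?case by measurable
  qed
  show "xs d k \<in> borel_measurable (H k)" using y by (intro step) auto
  show "xh d k \<in> borel_measurable (H k)" using y by (intro xh_measurable dt) auto
  show "subalgebra (H k) (info d k)" using y k by (intro info_least space_H) auto
qed

text \<open>The gain is random, but its operator norm is uniformly bounded by
  \<open>cov_bounded\<close>, so the correction inherits square integrability from the
  innovation.\<close>

lemma sq_integrable_loop:
  assumes d: "\<And>t. t \<le> N \<Longrightarrow> Measurable.pred M (d t)" and k: "k \<le> Suc N"
  shows "sq_integrable M (xs d k)" "sq_integrable M (xh d k)" "k \<le> N \<Longrightarrow> sq_integrable M (corr d k)"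
proof -
  have corr: "sq_integrable M (corr d k)"
    if k: "k \<le> N" and x: "sq_integrable M (xs d k)" "sq_integrable M (xh d k)" for k
  proof -
    have nu: "sq_integrable M (\<lambda>\<omega>. y d k \<omega> - C k *v xh d k \<omega>)"
      by (intro sq_integrable_diff sq_integrable_add sq_integrable_matrix_vector x v_sq k)
    obtain c where c: "\<And>\<omega>. onorm ((*v) (kgain A C V k (cov d k \<omega>))) \<le> c"
      using cov_bounded[of "\<lambda>P. onorm ((*v) (kgain A C V k P))"] by blast
    show ?thesis
      using nu
    proof (rule sq_integrable_bound[where c = c])
      show "corr d k \<in> borel_measurable M"
        using d k x v_sq[OF k] by (intro corr_measurable) (auto intro!: sq_integrable_measurable
            sq_integrable_add sq_integrable_matrix_vector)
      show "norm (corr d k \<omega>) \<le> c * norm (y d k \<omega> - C k *v xh d k \<omega>)" for \<omega>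
        by (rule order_trans[OF onorm[OF matrix_vector_mul_bounded_linear]])
          (intro mult_right_mono c norm_ge_zero)
    qed
  qed
  have "sq_integrable M (xs d k) \<and> sq_integrable M (xh d k)"
    using k
  proof (induction k)
    case 0
    show ?case using x0_sq sq_integrable_const by simp
  next
    case (Suc k)
    then have k: "k \<le> N" and x: "sq_integrable M (xs d k)" "sq_integrable M (xh d k)" by auto
    have "sq_integrable M (xs d (Suc k))" "sq_integrable M (xh d (Suc k))"
      unfolding xs_Suc xh_Suc
      by (intro sq_integrable_add sq_integrable_matrix_vector sq_integrable_uminus sq_integrable_if
          sq_integrable_const x w_sq k corr d)+
    then show ?case by simp
  qed
  then show "sq_integrable M (xs d k)" "sq_integrable M (xh d k)" "k \<le> N \<Longrightarrow> sq_integrable M (corr d k)"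
    using corr by auto
qed

lemma info_subalgebra:
  assumes d: "\<And>t. t \<le> N \<Longrightarrow> Measurable.pred M (d t)" and k: "k \<le> N"
  shows "subalgebra M (info d k)"
  using k sq_integrable_loop[OF d] v_sq
  by (intro info_least) (auto intro!: sq_integrable_measurable sq_integrable_add sq_integrable_matrix_vector)

text \<open>That \<open>info d k\<close> lies inside \<open>M\<close> already relies on
  measurability of the earlier decisions, hence the strong induction.\<close>

lemma adapted_measurable:
  assumes "adapted d" "k \<le> N"
  shows "Measurable.pred M (d k)"
  using assms(2)
proof (induction k rule: less_induct)
  case (less k)
  have xs: "xs d t \<in> borel_measurable M" if "t \<le> k" for t
    using that less by (intro xs_measurable sq_integrable_measurable[OF x0_sq]
        sq_integrable_measurable[OF w_sq] sq_integrable_measurable[OF v_sq]) auto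
  have "y d t \<in> borel_measurable M" if "t \<le> k" for t
    using xs[OF that] sq_integrable_measurable[OF v_sq[of t]] that less.prems by simp
  then have "subalgebra M (info d k)" by (intro info_least) auto
  then show ?case
    using assms(1) less.prems unfolding adapted_def by (auto intro: measurable_from_subalg)
qed

section \<open>Decomposition of the cost\<close>

abbreviation "cost d \<omega> \<equiv> icost A B C W V Q R th N m0 M0 x0 w v d \<omega>"

text \<open>The part of the cost whose expectation the trigger can influence once the squares are
  completed.\<close>

definition trigger_cost :: "(nat \<Rightarrow> 'w \<Rightarrow> bool) \<Rightarrow> 'w \<Rightarrow> real" where
  "trigger_cost d \<omega> = (\<Sum>k\<le>N. err d k \<omega> \<bullet> (\<Gamma> k *v err d k \<omega>) + th k * ind (d k \<omega>))"

lemma trigger_cost_cong: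
  assumes "\<And>t. t \<le> N \<Longrightarrow> d t \<omega> = d' t \<omega>"
  shows "trigger_cost d \<omega> = trigger_cost d' \<omega>"
proof -
  have "st d k \<omega> = st d' k \<omega>" if "k \<le> N" for k
    using assms that by (intro st_cong) auto
  then show ?thesis using assms by (simp add: trigger_cost_def)
qed

lemma cost_nonneg: "0 \<le> cost d \<omega>"
proof -
  have "0 \<le> x \<bullet> (Q k *v x)" if "k \<le> Suc N" for k x
    using Q_psd[OF that] by (simp add: psd_mat_def)
  moreover have "0 \<le> u \<bullet> (R k *v u)" if "k \<le> N" for k u
    using pd_mat_imp_psd_mat[OF R_pd[OF that]] by (simp add: psd_mat_def)
  moreover have "0 \<le> th k * ind b" if "k \<le> N" for k b
    using th_nonneg[OF that] by (simp add: ind_def)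
  ultimately show ?thesis
    unfolding icost_def Let_def by (intro add_nonneg_nonneg sum_nonneg) (simp only: atMost_iff le_SucI le_refl)+
qed

abbreviation "drift d k \<omega> \<equiv> A k *v xs d k \<omega> + B k *v (- (L k *v xh d k \<omega>))"

text \<open>Summing \<open>stage_cost_identity\<close> over time telescopes the value-function
  terms. The identity is pathwise and holds for any trigger.\<close>

lemma cost_decomposition:
  "cost d \<omega> = x0 \<omega> \<bullet> (S 0 *v x0 \<omega>) + (\<Sum>k\<le>N. w k \<omega> \<bullet> (S (Suc k) *v w k \<omega>))
     + (\<Sum>k\<le>N. 2 * (w k \<omega> \<bullet> (S (Suc k) *v drift d k \<omega>))) + trigger_cost d \<omega>"
proof -
  define u where "u k = - (L k *v xh d k \<omega>)" for k
  \<comment> \<open>Cutting the sum at \<open>n\<close> and closing it with the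
    \<open>S (Suc n)\<close>-form makes induction possible; at \<open>n = N\<close> this form is the
    terminal cost.\<close>
  have "(\<Sum>k\<le>n. xs d k \<omega> \<bullet> (Q k *v xs d k \<omega>) + u k \<bullet> (R k *v u k))
      + xs d (Suc n) \<omega> \<bullet> (S (Suc n) *v xs d (Suc n) \<omega>)
    = x0 \<omega> \<bullet> (S 0 *v x0 \<omega>) + (\<Sum>k\<le>n. err d k \<omega> \<bullet> (\<Gamma> k *v err d k \<omega>)
      + 2 * (w k \<omega> \<bullet> (S (Suc k) *v drift d k \<omega>)) + w k \<omega> \<bullet> (S (Suc k) *v w k \<omega>))"
    if "n \<le> N" for n
    using that
  proof (induction n)
    case 0
    show ?case
      using stage_cost_identity[of 0 "u 0" "xh d 0 \<omega>" "xs d 0 \<omega>" "w 0 \<omega>"]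
      by (simp add: u_def xs_Suc)
  next
    case (Suc n)
    from Suc.prems have "n \<le> N" by simp
    note Suc.IH[OF this]
    moreover note stage_cost_identity[OF Suc.prems u_def, of "xs d (Suc n) \<omega>" "w (Suc n) \<omega>"]
    ultimately show ?case
      unfolding xs_Suc[of d "Suc n"] sum.atMost_Suc u_def[of "Suc n", symmetric] by linarith
  qed
  from this[of N] show ?thesis
    by (simp only: icost_def trigger_cost_def Let_def S_end u_def sum.distrib) linarith
qed

lemma err_sq_integrable:
  assumes "\<And>t. t \<le> N \<Longrightarrow> Measurable.pred M (d t)" "k \<le> Suc N"
  shows "sq_integrable M (err d k)"
  using sq_integrable_loop[OF assms] by (intro sq_integrable_diff)

lemma ind_integrable:
  assumes "Measurable.pred M P"
  shows "integrable M (\<lambda>\<omega>. ind (P \<omega>))"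
proof (rule integrable_const_bound[where B = 1])
  show "(\<lambda>\<omega>. ind (P \<omega>)) \<in> borel_measurable M" unfolding ind_def using assms by measurable
qed (simp add: ind_def)

lemma trigger_cost_integrable:
  assumes d: "\<And>t. t \<le> N \<Longrightarrow> Measurable.pred M (d t)"
  shows "integrable M (trigger_cost d)"
  unfolding trigger_cost_def
  using d by (intro Bochner_Integration.integrable_sum Bochner_Integration.integrable_add
      sq_integrable_inner_integrable sq_integrable_matrix_vector err_sq_integrable
      integrable_mult_right ind_integrable) auto

lemma w_orth_inner:
  assumes k: "k \<le> N" and h: "h \<in> borel_measurable (H k)" "sq_integrable M h"
  shows "(\<integral>\<omega>. w k \<omega> \<bullet> h \<omega> \<partial>M) = 0"
proof -
  have hi: "(\<lambda>\<omega>. h \<omega> $ i) \<in> borel_measurable (H k)" for i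
  proof -
    have "(\<lambda>\<omega>. axis i 1 \<bullet> h \<omega>) \<in> borel_measurable (H k)" using h(1) by measurable
    then show ?thesis by (simp add: inner_axis')
  qed
  have int: "integrable M (\<lambda>\<omega>. w k \<omega> $ i * h \<omega> $ i)" for i
    using sq_integrable_inner_integrable[OF sq_integrable_component[OF w_sq[OF k]]
        sq_integrable_component[OF h(2)]] by simp
  have "(\<integral>\<omega>. w k \<omega> $ i * h \<omega> $ i \<partial>M) = 0" for i
    using w_orth[OF k hi sq_integrable_component[OF h(2)], of i "axis i 1"]
    by (simp add: inner_axis' mult.commute)
  then show ?thesis
    using int by (simp add: inner_vec_def Bochner_Integration.integral_sum)
qed

lemma expected_cost:
  assumes d: "adapted d"
  shows "integrable M (cost d)"
    "(\<integral>\<omega>. cost d \<omega> \<partial>M) = (\<integral>\<omega>. x0 \<omega> \<bullet> (S 0 *v x0 \<omega>) + (\<Sum>k\<le>N. w k \<omega> \<bullet> (S (Suc k) *v w k \<omega>)) \<partial>M)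
      + (\<integral>\<omega>. trigger_cost d \<omega> \<partial>M)"
proof -
  note dm = adapted_measurable[OF d]
  have drift: "sq_integrable M (\<lambda>\<omega>. S (Suc k) *v drift d k \<omega>)" if "k \<le> N" for k
    using sq_integrable_loop[of d, OF dm, of k] that
    by (intro sq_integrable_add sq_integrable_matrix_vector sq_integrable_uminus) auto
  have mart_int: "integrable M (\<lambda>\<omega>. 2 * (w k \<omega> \<bullet> (S (Suc k) *v drift d k \<omega>)))" if "k \<le> N" for k
    using that by (intro integrable_mult_right sq_integrable_inner_integrable w_sq drift)
  \<comment> \<open>The drift at time \<open>k\<close> is determined by the past \<open>H k\<close>,
    to which \<open>w k\<close> is orthogonal.\<close>
  have mart: "(\<integral>\<omega>. 2 * (w k \<omega> \<bullet> (S (Suc k) *v drift d k \<omega>)) \<partial>M) = 0" if "k \<le> N" for k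
  proof -
    have [measurable]: "xs d k \<in> borel_measurable (H k)" "xh d k \<in> borel_measurable (H k)"
      by (rule adapted_past(1,2)[OF d that])+
    have "(\<lambda>\<omega>. S (Suc k) *v drift d k \<omega>) \<in> borel_measurable (H k)" by measurable
    then show ?thesis using w_orth_inner[OF that _ drift[OF that]] by simp
  qed
  have c_int: "integrable M (\<lambda>\<omega>. x0 \<omega> \<bullet> (S 0 *v x0 \<omega>) + (\<Sum>k\<le>N. w k \<omega> \<bullet> (S (Suc k) *v w k \<omega>)))"
    by (intro Bochner_Integration.integrable_sum Bochner_Integration.integrable_add
      sq_integrable_inner_integrable sq_integrable_matrix_vector x0_sq w_sq) auto
  have m_int: "integrable M (\<lambda>\<omega>. \<Sum>k\<le>N. 2 * (w k \<omega> \<bullet> (S (Suc k) *v drift d k \<omega>)))"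
    using mart_int by (intro Bochner_Integration.integrable_sum) auto
  have m_0: "(\<integral>\<omega>. (\<Sum>k\<le>N. 2 * (w k \<omega> \<bullet> (S (Suc k) *v drift d k \<omega>))) \<partial>M) = 0"
    by (subst Bochner_Integration.integral_sum) (use mart mart_int in auto)
  have t_int: "integrable M (trigger_cost d)" by (rule trigger_cost_integrable[of d, OF dm])
  show "integrable M (cost d)"
    unfolding cost_decomposition
    by (intro Bochner_Integration.integrable_add[OF Bochner_Integration.integrable_add[OF c_int m_int] t_int])
  show "(\<integral>\<omega>. cost d \<omega> \<partial>M) = (\<integral>\<omega>. x0 \<omega> \<bullet> (S 0 *v x0 \<omega>) + (\<Sum>k\<le>N. w k \<omega> \<bullet> (S (Suc k) *v w k \<omega>)) \<partial>M)
      + (\<integral>\<omega>. trigger_cost d \<omega> \<partial>M)"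
    unfolding cost_decomposition
    by (simp only: Bochner_Integration.integral_add[OF Bochner_Integration.integrable_add[OF c_int m_int] t_int]
        Bochner_Integration.integral_add[OF c_int m_int] m_0)
qed

subsection \<open>The value of information as a conditional expectation\<close>

abbreviation "tail dbar d k b \<omega> \<equiv> iJ A B C W V Q R th N m0 M0 x0 w v dbar d k b \<omega>"
abbreviation "rho dbar d k \<omega> \<equiv> irho M A B C W V Q R th N m0 M0 x0 w v dbar d k \<omega>"

text \<open>In the theorem \<open>\<xi> k\<close> is a version of the conditional expectation of the state given
  \<open>info d k\<close>: the filtered state under imperfect, the state itself under perfect information.\<close>

definition voi :: "(nat \<Rightarrow> bool) \<Rightarrow> (nat \<Rightarrow> 'w \<Rightarrow> real^'n) \<Rightarrow> (nat \<Rightarrow> 'w \<Rightarrow> bool) \<Rightarrow> nat \<Rightarrow> 'w \<Rightarrow> real" where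
  "voi dbar \<xi> d k \<omega> = corr d k \<omega> \<bullet> (\<Gamma> (Suc k) *v
     (2 *\<^sub>R (A k *v (\<xi> k \<omega> - xh d k \<omega>)) - corr d k \<omega>)) - th k + rho dbar d k \<omega>"

lemma voi_measurable:
  assumes "\<And>t. t < k \<Longrightarrow> Measurable.pred (info d t) (d t)" "\<xi> k \<in> borel_measurable (info d k)"
  shows "voi dbar \<xi> d k \<in> borel_measurable (info d k)"
proof -
  note [measurable] = assms(2) xh_info[OF assms(1)]
  show ?thesis unfolding voi_def irho_def Let_def by measurable
qed

text \<open>The threshold at time \<open>k\<close> involves only decisions before \<open>k\<close>,
  so measurability propagates forward in time.\<close>

lemma adapted_voi_policy:
  assumes "\<And>k \<omega>. k \<le> N \<Longrightarrow> d k \<omega> \<longleftrightarrow> 0 \<le> voi dbar \<xi> d k \<omega>"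
    and "\<And>k. k \<le> N \<Longrightarrow> \<xi> k \<in> borel_measurable (info d k)"
  shows "adapted d"
proof -
  have "Measurable.pred (info d k) (d k)" if "k \<le> N" for k
    using that
  proof (induction k rule: less_induct)
    case (less k)
    have [measurable]: "voi dbar \<xi> d k \<in> borel_measurable (info d k)"
      using less assms(2) by (intro voi_measurable) auto
    have "d k = (\<lambda>\<omega>. 0 \<le> voi dbar \<xi> d k \<omega>)" using assms(1) less.prems by auto
    then show ?case by simp
  qed
  then show ?thesis by (simp add: adapted_def)
qed

lemma switch_measurable:
  assumes "\<And>t. t \<le> N \<Longrightarrow> Measurable.pred M (d t)" "t \<le> N"
  shows "Measurable.pred M (switch_at d k b dbar t)"
  using assms by (cases t k rule: linorder_cases) (auto simp: switch_at_def)

lemma st_switch: "t \<le> k \<Longrightarrow> st (switch_at d k b dbar) t \<omega> = st d t \<omega>"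
  by (intro st_cong) (auto simp: switch_at_def)

lemma tail_integrable:
  assumes "\<And>t. t \<le> N \<Longrightarrow> Measurable.pred M (d t)"
  shows "integrable M (tail dbar d k b)"
  unfolding iJ_def Let_def
  using switch_measurable[OF assms]
  by (intro Bochner_Integration.integrable_sum Bochner_Integration.integrable_add
      sq_integrable_inner_integrable sq_integrable_matrix_vector err_sq_integrable) auto

text \<open>This isolates the effect of the bit \<open>b\<close>: errors up to \<open>k\<close> do
  not see it, the error at \<open>Suc k\<close> is explicit, and everything later is in
  \<open>tail\<close>.\<close>

lemma trigger_cost_switch:
  assumes k: "k \<le> N"
  shows "trigger_cost (switch_at d k b dbar) \<omega>
    = (\<Sum>t\<le>k. err d t \<omega> \<bullet> (\<Gamma> t *v err d t \<omega>)) + (\<Sum>t<k. th t * ind (d t \<omega>)) + th k * ind b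
      + (A k *v err d k \<omega> + w k \<omega> - (if b then corr d k \<omega> else 0))
          \<bullet> (\<Gamma> (Suc k) *v (A k *v err d k \<omega> + w k \<omega> - (if b then corr d k \<omega> else 0)))
      + tail dbar d k b \<omega>"
proof -
  let ?d = "switch_at d k b dbar"
  define g where "g t = err ?d t \<omega> \<bullet> (\<Gamma> t *v err ?d t \<omega>)" for t
  have split: "{..N} = {..k} \<union> {Suc k..N}" "{..k} \<inter> {Suc k..N} = {}" using k by auto
  \<comment> \<open>Extending the sum by the term at \<open>Suc N\<close> is free because
    \<open>\<Gamma> (Suc N) = 0\<close>; it matches \<open>tail\<close>, whose error terms run from
    \<open>k + 2\<close> to \<open>Suc N\<close>.\<close>
  have "(\<Sum>t\<le>Suc N. g t) = (\<Sum>t\<le>k. g t) + (\<Sum>t=Suc k..Suc N. g t)"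
  proof -
    have "{..Suc N} = {..k} \<union> {Suc k..Suc N}" "{..k} \<inter> {Suc k..Suc N} = {}" using k by auto
    then show ?thesis by (simp add: sum.union_disjoint del: atMost_Suc sum.atMost_Suc)
  qed
  also have "(\<Sum>t=Suc k..Suc N. g t) = g (Suc k) + (\<Sum>t=Suc k..N. g (Suc t))"
    using k by (simp add: sum.atLeast_Suc_atMost sum.shift_bounds_cl_Suc_ivl del: sum.cl_ivl_Suc)
  finally have g: "(\<Sum>t\<le>N. g t) = (\<Sum>t\<le>k. g t) + g (Suc k) + (\<Sum>t=Suc k..N. g (Suc t))"
    by (simp add: g_def Gamma_end)
  have "(\<Sum>t\<le>N. th t * ind (?d t \<omega>)) = (\<Sum>t\<le>k. th t * ind (?d t \<omega>)) + (\<Sum>t=Suc k..N. th t * ind (?d t \<omega>))"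
    by (simp only: split(1)) (simp add: sum.union_disjoint split(2))
  also have "(\<Sum>t=Suc k..N. th t * ind (?d t \<omega>)) = (\<Sum>t=Suc k..N. th t * ind (dbar t))"
    by (intro sum.cong) (auto simp: switch_at_def)
  also have "(\<Sum>t\<le>k. th t * ind (?d t \<omega>)) = (\<Sum>t<k. th t * ind (d t \<omega>)) + th k * ind b"
    unfolding lessThan_Suc_atMost[symmetric] sum.lessThan_Suc
    by (simp add: switch_at_def)
  finally have t: "(\<Sum>t\<le>N. th t * ind (?d t \<omega>))
      = (\<Sum>t<k. th t * ind (d t \<omega>)) + th k * ind b + (\<Sum>t=Suc k..N. th t * ind (dbar t))" .
  have "(\<Sum>t\<le>k. g t) = (\<Sum>t\<le>k. err d t \<omega> \<bullet> (\<Gamma> t *v err d t \<omega>))"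
    by (intro sum.cong) (auto simp: g_def st_switch)
  moreover have "err ?d (Suc k) \<omega> = A k *v err d k \<omega> + w k \<omega> - (if b then corr d k \<omega> else 0)"
    unfolding err_Suc st_switch[OF order_refl] by (simp add: switch_at_def)
  ultimately show ?thesis
    using g t by (simp add: trigger_cost_def iJ_def Let_def sum.distrib g_def)
qed

text \<open>The gap has the form of the value of information with the true state in place of the
  filtered one, plus a cross term in \<open>w k\<close> that vanishes on averaging.\<close>

lemma trigger_cost_gap:
  assumes k: "k \<le> N"
  shows "trigger_cost (switch_at d k False dbar) \<omega> - trigger_cost (switch_at d k True dbar) \<omega>
    = corr d k \<omega> \<bullet> (\<Gamma> (Suc k) *v (2 *\<^sub>R (A k *v (xs d k \<omega> - xh d k \<omega>)) - corr d k \<omega>)) - th k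
      + 2 * (w k \<omega> \<bullet> (\<Gamma> (Suc k) *v corr d k \<omega>))
      + (tail dbar d k False \<omega> - tail dbar d k True \<omega>)"
proof -
  have sym: "transpose (\<Gamma> (Suc k)) = \<Gamma> (Suc k)" using k by (intro Gamma_symmetric) simp
  define a where "a = A k *v err d k \<omega>"
  define c where "c = corr d k \<omega>"
  \<comment> \<open>For symmetric \<open>\<Gamma>\<close> and \<open>p = a + w\<close>, the
    difference of the forms at \<open>p\<close> and \<open>p - c\<close> is the pairing of
    \<open>c\<close> with \<open>\<Gamma> (2p - c)\<close>.\<close>
  have "(a + w k \<omega>) \<bullet> (\<Gamma> (Suc k) *v (a + w k \<omega>)) - (a + w k \<omega> - c) \<bullet> (\<Gamma> (Suc k) *v (a + w k \<omega> - c))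
      = c \<bullet> (\<Gamma> (Suc k) *v (2 *\<^sub>R a - c)) + 2 * (w k \<omega> \<bullet> (\<Gamma> (Suc k) *v c))"
    using symmetric_inner_swap[OF sym, of c a] symmetric_inner_swap[OF sym, of c "w k \<omega>"]
    by (simp add: matrix_vector_right_distrib matrix_vector_mult_diff_distrib inner_add_left
        inner_add_right inner_diff_left inner_diff_right matrix_vector_mult_scaleR)
  then show ?thesis
    unfolding trigger_cost_switch[OF k] a_def c_def by (simp add: ind_def)
qed

text \<open>Tested against events of the trigger's information, this says that \<open>voi\<close> is
  the conditional expectation of the gap. The gap is affine in the state with coefficients known to
  the trigger, so the state may be exchanged for \<open>\<xi> k\<close>.\<close>

lemma voi_gap_integral:
  assumes d: "adapted d" and k: "k \<le> N"
    and \<xi>: "\<xi> k \<in> borel_measurable (info d k)"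
      "\<And>i. AE \<omega> in M. \<xi> k \<omega> $ i = real_cond_exp M (info d k) (\<lambda>\<omega>. xs d k \<omega> $ i) \<omega>"
    and E: "E \<in> sets (info d k)"
  shows "(\<integral>\<omega>. indicator E \<omega> * (trigger_cost (switch_at d k False dbar) \<omega>
            - trigger_cost (switch_at d k True dbar) \<omega>) \<partial>M)
    = (\<integral>\<omega>. indicator E \<omega> * voi dbar \<xi> d k \<omega> \<partial>M)"
proof -
  note dm = adapted_measurable[OF d]
  have sub: "subalgebra M (info d k)" by (rule info_subalgebra[of d, OF dm k])
  interpret F: finite_measure_subalgebra M "info d k"
    by unfold_locales (rule sub)
  have EM [measurable]: "E \<in> sets M" using sub E by (auto simp: subalgebra_def)
  have dt: "\<And>t. t < k \<Longrightarrow> Measurable.pred (info d t) (d t)" using d k by (simp add: adapted_def)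
  note [measurable] = xh_info[OF dt] E
  have k': "k \<le> Suc N" using k by simp
  note sq = sq_integrable_loop[of d, OF dm k']
  \<comment> \<open>Localising the correction to \<open>E\<close> turns the indicator into part of a
    vector that is still known to the trigger.\<close>
  define h where "h \<omega> = (if \<omega> \<in> E then corr d k \<omega> else 0)" for \<omega>
  have h_F [measurable]: "h \<in> borel_measurable (info d k)" unfolding h_def by measurable
  have h_sq: "sq_integrable M h"
    unfolding h_def by (intro sq_integrable_if sq(3) sq_integrable_const k) measurable
  \<comment> \<open>The coefficient of the state: moving \<open>A k\<close> and
    \<open>\<Gamma> (Suc k)\<close> to the side of \<open>h\<close> by transposition leaves a plain
    inner product with the state.\<close>
  define g where "g \<omega> = 2 *\<^sub>R (transpose (A k) *v (transpose (\<Gamma> (Suc k)) *v h \<omega>))" for \<omega>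
  have g_F: "g \<in> borel_measurable (info d k)" unfolding g_def by measurable
  have g_sq: "sq_integrable M g"
  proof -
    have "g = (\<lambda>\<omega>. transpose (A k) *v (transpose (\<Gamma> (Suc k)) *v h \<omega>)
        + transpose (A k) *v (transpose (\<Gamma> (Suc k)) *v h \<omega>))"
      by (simp add: g_def scaleR_2 fun_eq_iff del: transpose_matrix_vector)
    then show ?thesis
      by (simp only:) (intro sq_integrable_add sq_integrable_matrix_vector h_sq)
  qed
  have g_inner: "g \<omega> \<bullet> z = h \<omega> \<bullet> (\<Gamma> (Suc k) *v (2 *\<^sub>R (A k *v z)))" for \<omega> z
    by (simp add: g_def inner_transpose_mult_vec matrix_vector_mult_scaleR inner_commute[of _ z]
        inner_commute[of _ "h \<omega>"] del: transpose_matrix_vector)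
  have \<xi>M: "\<xi> k \<in> borel_measurable M" by (rule measurable_from_subalg[OF sub \<xi>(1)])
  note ce = F.inner_cond_exp_integral[OF g_F g_sq sq(1) \<xi>M \<xi>(2)]
  \<comment> \<open>The terms free of the state, common to both sides of the claim.\<close>
  define r where "r \<omega> = - (h \<omega> \<bullet> (\<Gamma> (Suc k) *v (2 *\<^sub>R (A k *v xh d k \<omega>) + corr d k \<omega>)))
    - indicator E \<omega> * th k" for \<omega>
  have r_int: "integrable M r"
  proof -
    have "sq_integrable M (\<lambda>\<omega>. 2 *\<^sub>R (A k *v xh d k \<omega>) + corr d k \<omega>)"
      unfolding scaleR_2 by (intro sq_integrable_add sq_integrable_matrix_vector sq k)
    moreover have "integrable M (\<lambda>\<omega>. indicator E \<omega> * th k)"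
      using integrable_mult_indicator[OF EM integrable_const[of "th k"]] by simp
    ultimately show ?thesis
      unfolding r_def by (intro Bochner_Integration.integrable_diff integrable_minus
          sq_integrable_inner_integrable sq_integrable_matrix_vector h_sq) auto
  qed
  define T where "T b = tail dbar d k b" for b
  have T_int: "integrable M (T b)" for b
    unfolding T_def by (rule tail_integrable[of d, OF dm])
  let ?CE = "real_cond_exp M (info d k)"
  have T_ce: "integrable M (\<lambda>\<omega>. indicator E \<omega> * ?CE (T b) \<omega>)"
    "(\<integral>\<omega>. indicator E \<omega> * ?CE (T b) \<omega> \<partial>M) = (\<integral>\<omega>. indicator E \<omega> * T b \<omega> \<partial>M)"
    and T_intE: "integrable M (\<lambda>\<omega>. indicator E \<omega> * T b \<omega>)" for b
  proof -
    show *: "integrable M (\<lambda>\<omega>. indicator E \<omega> * T b \<omega>)"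
      using integrable_mult_indicator[OF EM T_int] by simp
    show "integrable M (\<lambda>\<omega>. indicator E \<omega> * ?CE (T b) \<omega>)"
      "(\<integral>\<omega>. indicator E \<omega> * ?CE (T b) \<omega> \<partial>M) = (\<integral>\<omega>. indicator E \<omega> * T b \<omega> \<partial>M)"
      using F.real_cond_exp_intg[OF *] T_int[of b] E by auto
  qed
  have n_int: "integrable M (\<lambda>\<omega>. 2 * (w k \<omega> \<bullet> (\<Gamma> (Suc k) *v h \<omega>)))"
    by (intro integrable_mult_right sq_integrable_inner_integrable sq_integrable_matrix_vector h_sq w_sq k)
  have n_0: "(\<integral>\<omega>. 2 * (w k \<omega> \<bullet> (\<Gamma> (Suc k) *v h \<omega>)) \<partial>M) = 0"
  proof -
    have [measurable]: "h \<in> borel_measurable (H k)"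
      by (rule measurable_from_subalg[OF adapted_past(3)[OF d k] h_F])
    have "(\<lambda>\<omega>. \<Gamma> (Suc k) *v h \<omega>) \<in> borel_measurable (H k)" by measurable
    then show ?thesis
      using w_orth_inner[OF k _ sq_integrable_matrix_vector[OF h_sq]] by simp
  qed
  have gX_int: "integrable M (\<lambda>\<omega>. g \<omega> \<bullet> xs d k \<omega>)"
    by (rule sq_integrable_inner_integrable[OF g_sq sq(1)])
  have ind_corr: "indicator E \<omega> * (corr d k \<omega> \<bullet> z) = h \<omega> \<bullet> z" for \<omega> z
    by (simp add: h_def indicator_def)
  have split: "h \<omega> \<bullet> (\<Gamma> (Suc k) *v (2 *\<^sub>R (A k *v (z - xh d k \<omega>)) - corr d k \<omega>)) - indicator E \<omega> * th k
      = g \<omega> \<bullet> z + r \<omega>" for \<omega> z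
    unfolding g_inner r_def
    by (simp add: matrix_vector_mult_diff_distrib matrix_vector_right_distrib scaleR_diff_right
        inner_diff_right inner_add_right)
  have lhs: "indicator E \<omega> * (trigger_cost (switch_at d k False dbar) \<omega>
            - trigger_cost (switch_at d k True dbar) \<omega>)
      = (g \<omega> \<bullet> xs d k \<omega> + r \<omega>) + 2 * (w k \<omega> \<bullet> (\<Gamma> (Suc k) *v h \<omega>))
        + (indicator E \<omega> * T False \<omega> - indicator E \<omega> * T True \<omega>)" for \<omega>
    unfolding trigger_cost_gap[OF k] split[symmetric] ind_corr[symmetric] T_def
    by (simp add: h_def indicator_def)
  have rhs: "indicator E \<omega> * voi dbar \<xi> d k \<omega> = (g \<omega> \<bullet> \<xi> k \<omega> + r \<omega>)
        + (indicator E \<omega> * ?CE (T False) \<omega> - indicator E \<omega> * ?CE (T True) \<omega>)" for \<omega>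
    unfolding voi_def irho_def Let_def split[symmetric] ind_corr[symmetric] T_def
    by (simp add: algebra_simps)
  show ?thesis
    unfolding lhs rhs
    using ce T_ce T_intE n_int n_0 gX_int r_int by simp
qed

subsection \<open>Policy improvement\<close>

text \<open>Only the event on which the decision differs from \<open>dbar k\<close> contributes, and
  there the sign of \<open>voi\<close> equals the sign of the averaged gap.\<close>

lemma policy_improvement_step:
  assumes d: "adapted d" and k: "k \<le> N"
    and \<xi>: "\<xi> k \<in> borel_measurable (info d k)"
      "\<And>i. AE \<omega> in M. \<xi> k \<omega> $ i = real_cond_exp M (info d k) (\<lambda>\<omega>. xs d k \<omega> $ i) \<omega>"
    and policy: "\<And>\<omega>. d k \<omega> \<longleftrightarrow> 0 \<le> voi dbar \<xi> d k \<omega>"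
  shows "(\<integral>\<omega>. trigger_cost (switch_at d k (d k \<omega>) dbar) \<omega> \<partial>M)
    \<le> (\<integral>\<omega>. trigger_cost (switch_at d k (dbar k) dbar) \<omega> \<partial>M)"
proof -
  note dm = adapted_measurable[OF d]
  define J where "J b = trigger_cost (switch_at d k b dbar)" for b
  have J_int: "integrable M (J b)" for b
    unfolding J_def by (rule trigger_cost_integrable[OF switch_measurable[of d, OF dm]])
  define E where "E b = {\<omega> \<in> space M. d k \<omega> = b}" for b
  have [measurable]: "Measurable.pred (info d k) (d k)" using d k by (simp add: adapted_def)
  have "{\<omega> \<in> space (info d k). d k \<omega> = b} \<in> sets (info d k)" for b by measurable
  then have E: "E b \<in> sets (info d k)" for b by (simp add: E_def)
  have EM: "E b \<in> sets M" for b using E info_subalgebra[of d, OF dm k] by (auto simp: subalgebra_def)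
  have gap: "(\<integral>\<omega>. indicator (E b) \<omega> * (J False \<omega> - J True \<omega>) \<partial>M)
      = (\<integral>\<omega>. indicator (E b) \<omega> * voi dbar \<xi> d k \<omega> \<partial>M)" for b
    unfolding J_def by (rule voi_gap_integral[where \<xi> = \<xi>, OF d k \<xi> E])
  have int: "integrable M (\<lambda>\<omega>. indicator (E b) \<omega> * (J False \<omega> - J True \<omega>))" for b
    using integrable_mult_indicator[OF EM Bochner_Integration.integrable_diff[OF J_int J_int]] by simp
  have pos: "0 \<le> (\<integral>\<omega>. indicator (E True) \<omega> * (J False \<omega> - J True \<omega>) \<partial>M)"
    unfolding gap by (intro Bochner_Integration.integral_nonneg) (auto simp: E_def indicator_def policy)
  have "0 \<le> (\<integral>\<omega>. - (indicator (E False) \<omega> * voi dbar \<xi> d k \<omega>) \<partial>M)"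
    by (intro Bochner_Integration.integral_nonneg) (auto simp: E_def indicator_def policy)
  then have neg: "(\<integral>\<omega>. indicator (E False) \<omega> * (J False \<omega> - J True \<omega>) \<partial>M) \<le> 0"
    unfolding gap by simp
  have "(\<integral>\<omega>. J (d k \<omega>) \<omega> \<partial>M) \<le> (\<integral>\<omega>. J (dbar k) \<omega> \<partial>M)"
  proof (cases "dbar k")
    case True
    have "(\<integral>\<omega>. J (d k \<omega>) \<omega> \<partial>M) = (\<integral>\<omega>. J True \<omega> + indicator (E False) \<omega> * (J False \<omega> - J True \<omega>) \<partial>M)"
      by (intro Bochner_Integration.integral_cong) (auto simp: E_def indicator_def)
    then show ?thesis using True neg int J_int by simp
  next
    case False
    have "(\<integral>\<omega>. J (d k \<omega>) \<omega> \<partial>M) = (\<integral>\<omega>. J False \<omega> - indicator (E True) \<omega> * (J False \<omega> - J True \<omega>) \<partial>M)"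
      by (intro Bochner_Integration.integral_cong) (auto simp: E_def indicator_def)
    then show ?thesis using False pos int J_int by simp
  qed
  then show ?thesis by (simp add: J_def)
qed

theorem policy_improvement:
  assumes d: "adapted d"
    and \<xi>: "\<And>k. k \<le> N \<Longrightarrow> \<xi> k \<in> borel_measurable (info d k)"
      "\<And>k i. k \<le> N \<Longrightarrow> AE \<omega> in M. \<xi> k \<omega> $ i = real_cond_exp M (info d k) (\<lambda>\<omega>. xs d k \<omega> $ i) \<omega>"
    and policy: "\<And>k \<omega>. k \<le> N \<Longrightarrow> d k \<omega> \<longleftrightarrow> 0 \<le> voi dbar \<xi> d k \<omega>"
  shows "iPsi M A B C W V Q R th N m0 M0 x0 w v d
    \<le> iPsi M A B C W V Q R th N m0 M0 x0 w v (\<lambda>k _. dbar k)"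
proof -
  define mix where "mix j t \<omega> = (if t < j then d t \<omega> else dbar t)" for j t \<omega>
  have step: "(\<integral>\<omega>. trigger_cost (mix (Suc j)) \<omega> \<partial>M) \<le> (\<integral>\<omega>. trigger_cost (mix j) \<omega> \<partial>M)"
    if j: "j \<le> N" for j
  proof -
    \<comment> \<open>On each path the decision at \<open>j\<close> may be frozen to its realised
      value, as the trigger cost depends on the decisions along that path alone.\<close>
    have "trigger_cost (mix (Suc j)) \<omega> = trigger_cost (switch_at d j (d j \<omega>) dbar) \<omega>" for \<omega>
      by (rule trigger_cost_cong) (auto simp: mix_def switch_at_def less_Suc_eq)
    moreover have "trigger_cost (mix j) \<omega> = trigger_cost (switch_at d j (dbar j) dbar) \<omega>" for \<omega>
      by (rule trigger_cost_cong) (auto simp: mix_def switch_at_def)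
    ultimately show ?thesis
      using policy_improvement_step[where \<xi> = \<xi>, OF d j \<xi>(1)[OF j] \<xi>(2)[OF j] policy[OF j]] by simp
  qed
  have "(\<integral>\<omega>. trigger_cost (mix j) \<omega> \<partial>M) \<le> (\<integral>\<omega>. trigger_cost (mix 0) \<omega> \<partial>M)" if "j \<le> Suc N" for j
    using that
  proof (induction j)
    case (Suc j)
    then show ?case using step[of j] by simp
  qed simp
  from this[of "Suc N"]
  have "(\<integral>\<omega>. trigger_cost (mix (Suc N)) \<omega> \<partial>M) \<le> (\<integral>\<omega>. trigger_cost (mix 0) \<omega> \<partial>M)" by simp
  moreover have "trigger_cost (mix (Suc N)) \<omega> = trigger_cost d \<omega>" for \<omega>
    by (rule trigger_cost_cong) (simp add: mix_def)
  moreover have "mix 0 = (\<lambda>k _. dbar k)" by (simp add: mix_def fun_eq_iff)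
  ultimately have "(\<integral>\<omega>. trigger_cost d \<omega> \<partial>M) \<le> (\<integral>\<omega>. trigger_cost (\<lambda>k _. dbar k) \<omega> \<partial>M)"
    by simp
  \<comment> \<open>Both expected costs contain the same constant, so the comparison of trigger
    costs carries over.\<close>
  then have "(\<integral>\<omega>. cost d \<omega> \<partial>M) \<le> (\<integral>\<omega>. cost (\<lambda>k _. dbar k) \<omega> \<partial>M)"
    by (simp add: expected_cost(2)[OF d] expected_cost(2)[OF adapted_const])
  then show ?thesis
    unfolding iPsi_def
    by (simp add: nn_integral_eq_integral expected_cost(1)[OF d] expected_cost(1)[OF adapted_const]
        cost_nonneg ennreal_leI)
qed

end

section \<open>Tools shared by the two information settings\<close>

lemma switch_at_cong:
  assumes "\<And>t. t < k \<Longrightarrow> d t = d' t"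
  shows "switch_at d k b dbar = switch_at d' k b dbar"
  using assms by (auto simp: switch_at_def fun_eq_iff)

text \<open>Independence factors the expectation and the noise has mean zero. The map
  \<open>p\<close> extracts the noise from a primitive variable that may be padded to a
  pair.\<close>

lemma (in prob_space) noise_orthogonal:
  fixes h :: "'a \<Rightarrow> real" and X :: "'i \<Rightarrow> 'a \<Rightarrow> 'b::topological_space" and z :: "'a \<Rightarrow> real^'n"
  assumes indep: "indep_vars (\<lambda>_. borel) X I" and j: "j \<in> I" "j \<notin> J" "J \<subseteq> I"
    and h: "h \<in> borel_measurable (generated_info M X J)" "sq_integrable M h"
    and z: "gaussian_rv M z 0 \<Sigma>" "psd_mat \<Sigma>"
    and p: "p \<in> borel_measurable borel" "\<And>\<omega>. z \<omega> = p (X j \<omega>)"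
  shows "(\<integral>\<omega>. h \<omega> * (a \<bullet> z \<omega>) \<partial>M) = 0"
proof -
  have "integrable M h"
    using sq_integrable_inner_integrable[OF h(2) sq_integrable_const[of 1]] by simp
  moreover have "(\<lambda>x. a \<bullet> p x) \<in> borel_measurable borel" using p(1) by measurable
  ultimately show ?thesis
    using indep_generated_info_integral[OF indep j h(1), of "\<lambda>x. a \<bullet> p x"]
      gaussian_rv_moments(1,2)[OF z, of a] by (simp add: p(2))
qed

section \<open>Imperfect information\<close>

text \<open>In contrast to \<open>st_cong\<close>, this is equality of functions on the sample
  space, as conditional expectations and generated information require.\<close>

lemma icl_cong:
  assumes "\<And>t. t < k \<Longrightarrow> d t = d' t"
  shows "icl A B C W V L m0 M0 x0 w v d k = icl A B C W V L m0 M0 x0 w v d' k"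
  using assms
proof (induction k)
  case (Suc k)
  then have "icl A B C W V L m0 M0 x0 w v d k = icl A B C W V L m0 M0 x0 w v d' k" "d k = d' k"
    by auto
  then show ?case by (simp add: fun_eq_iff)
qed (simp add: fun_eq_iff)

lemma iVoI_cong:
  assumes "\<And>t. t < k \<Longrightarrow> d t = d' t"
  shows "iVoI M A B C W V Q R th N m0 M0 x0 w v dbar d k
    = iVoI M A B C W V Q R th N m0 M0 x0 w v dbar d' k"
proof -
  have st: "icl A B C W V L m0 M0 x0 w v d t = icl A B C W V L m0 M0 x0 w v d' t"
    if "t \<le> k" for t L using assms that by (intro icl_cong) auto
  have "iinfo M A B C W V L m0 M0 x0 w v d k = iinfo M A B C W V L m0 M0 x0 w v d' k" for L
    unfolding iinfo_def by (intro arg_cong[where f = "sigma (space M)"] SUP_cong refl) (simp add: st)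
  moreover have "iJ A B C W V Q R th N m0 M0 x0 w v dbar d k b
      = iJ A B C W V Q R th N m0 M0 x0 w v dbar d' k b" for b
    by (rule ext) (simp only: iJ_def switch_at_cong[of k d d', OF assms])
  ultimately show ?thesis
    by (intro ext) (simp add: iVoI_def irho_def st Let_def)
qed

lemma iplus_pre_eq_iplus:
  "t < k \<Longrightarrow> iplus_pre M A B C W V Q R th N m0 M0 x0 w v dbar k t
    = iplus M A B C W V Q R th N m0 M0 x0 w v dbar t"
  by (induction k) (auto simp: iplus_def less_Suc_eq)

text \<open>By causality the prefix sequence in the recursive definition may be replaced by the
  policy itself, giving the fixed-point form used in \<open>policy_improvement\<close>.\<close>

lemma iplus_iff:
  "iplus M A B C W V Q R th N m0 M0 x0 w v dbar k \<omega> \<longleftrightarrow>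
    0 \<le> iVoI M A B C W V Q R th N m0 M0 x0 w v dbar (iplus M A B C W V Q R th N m0 M0 x0 w v dbar) k \<omega>"
proof -
  have "iVoI M A B C W V Q R th N m0 M0 x0 w v dbar (iplus_pre M A B C W V Q R th N m0 M0 x0 w v dbar k) k
    = iVoI M A B C W V Q R th N m0 M0 x0 w v dbar (iplus M A B C W V Q R th N m0 M0 x0 w v dbar) k"
    by (intro iVoI_cong iplus_pre_eq_iplus)
  then show ?thesis by (simp add: iplus_def[of _ _ _ _ _ _ _ _ _ _ _ _ _ _ _ _ k])
qed

lemma imperfect_improvement:
  fixes C :: "nat \<Rightarrow> real^'n^'p" and V :: "nat \<Rightarrow> real^'p^'p" and v :: "nat \<Rightarrow> 'w \<Rightarrow> real^'p"
  assumes model: "perfect_model M A B Q R W th N m0 M0 x0 w"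
    and imperfect: "imperfect_model M A C V N x0 w v"
  shows "iPsi M A B C W V Q R th N m0 M0 x0 w v (iplus M A B C W V Q R th N m0 M0 x0 w v dbar)
    \<le> iPsi M A B C W V Q R th N m0 M0 x0 w v (\<lambda>k _. dbar k)"
proof -
  interpret prob_space M using model by (simp add: perfect_model_def)
  define X where "X i = (case i of X0 \<Rightarrow> (\<lambda>\<omega>. (x0 \<omega>, 0 :: real^'p))
    | Wn k \<Rightarrow> (\<lambda>\<omega>. (w k \<omega>, 0 :: real^'p)) | Vn k \<Rightarrow> (\<lambda>\<omega>. (0 :: real^'n, v k \<omega>)))" for i
  \<comment> \<open>The past at \<open>k\<close> contains \<open>v k\<close>, which enters the
    observation seen before deciding, but not \<open>w k\<close>, which only acts on the next
    state.\<close>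
  let ?J = "\<lambda>k. insert X0 (Wn ` {..<k} \<union> Vn ` {..k})"
  have W: "psd_mat (W k)" and V: "psd_mat (V k)"
    and gw: "gaussian_rv M (w k) 0 (W k)" and gv: "gaussian_rv M (v k) 0 (V k)" if "k \<le> N" for k
    using model imperfect that
    by (simp_all add: perfect_model_def imperfect_model_def pd_mat_imp_psd_mat)
  have gx: "gaussian_rv M x0 m0 M0" "psd_mat M0" using model by (auto simp: perfect_model_def)
  have indep: "indep_vars (\<lambda>_. borel) X (insert X0 (Wn ` {..N} \<union> Vn ` {..N}))"
    using imperfect unfolding imperfect_model_def X_def by blast
  have fst_snd: "fst \<in> borel_measurable (borel :: ((real^'n) \<times> (real^'p)) measure)"
    "snd \<in> borel_measurable (borel :: ((real^'n) \<times> (real^'p)) measure)"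
    by (intro borel_measurable_continuous_onI continuous_intros)+
  note comp = measurable_compose[OF measurable_generated_info fst_snd(1)]
    measurable_compose[OF measurable_generated_info fst_snd(2)]
  interpret triggered_lq M A B Q R N C W V th m0 M0 x0 w v "\<lambda>k. generated_info M X (?J k)"
  proof unfold_locales
    fix k :: nat and h :: "'w \<Rightarrow> real" and a
    show "k \<le> Suc N \<Longrightarrow> psd_mat (Q k)" "k \<le> N \<Longrightarrow> pd_mat (R k)" "k \<le> N \<Longrightarrow> 0 \<le> th k"
      using model by (auto simp: perfect_model_def)
    show "sq_integrable M x0" by (rule gaussian_rv_sq_integrable[OF gx])
    show "k \<le> N \<Longrightarrow> sq_integrable M (w k)" by (rule gaussian_rv_sq_integrable[OF gw W])
    show "k \<le> N \<Longrightarrow> sq_integrable M (v k)" by (rule gaussian_rv_sq_integrable[OF gv V])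
    show "space (generated_info M X (?J k)) = space M" by (rule space_generated_info)
    show "x0 \<in> borel_measurable (generated_info M X (?J k))"
      using comp(1)[of X0 "?J k" X M] by (simp add: X_def)
    show "w t \<in> borel_measurable (generated_info M X (?J k))" if "t < k" for t
      using comp(1)[of "Wn t" "?J k" X M] that by (simp add: X_def)
    show "v t \<in> borel_measurable (generated_info M X (?J k))" if "t \<le> k" for t
      using comp(2)[of "Vn t" "?J k" X M] that by (simp add: X_def)
    show "(\<integral>\<omega>. h \<omega> * (a \<bullet> w k \<omega>) \<partial>M) = 0"
      if k: "k \<le> N" and h: "h \<in> borel_measurable (generated_info M X (?J k))" "sq_integrable M h"
      using k by (intro noise_orthogonal[OF indep _ _ _ h gw[OF k] W[OF k] fst_snd(1), of "Wn k"])
        (auto simp: X_def)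
  qed
  define d where "d = iplus M A B C W V Q R th N m0 M0 x0 w v dbar"
  \<comment> \<open>With the componentwise conditional expectation as the version,
    \<open>voi\<close> is literally \<open>iVoI\<close>.\<close>
  define \<xi> where "\<xi> k \<omega> = (\<chi> i. real_cond_exp M (info d k) (\<lambda>\<omega>'. xs d k \<omega>' $ i) \<omega>)" for k \<omega>
  have \<xi>: "\<xi> k \<in> borel_measurable (info d k)" for k
    unfolding \<xi>_def by (subst borel_measurable_euclidean_space)
      (auto simp: Basis_vec_def inner_axis)
  have policy: "d k \<omega> \<longleftrightarrow> 0 \<le> voi dbar \<xi> d k \<omega>" for k \<omega>
    unfolding d_def by (subst iplus_iff) (simp add: iVoI_def voi_def Let_def \<xi>_def d_def)
  have "adapted d" using policy \<xi> by (intro adapted_voi_policy) auto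
  then have "iPsi M A B C W V Q R th N m0 M0 x0 w v d
    \<le> iPsi M A B C W V Q R th N m0 M0 x0 w v (\<lambda>k _. dbar k)"
    using \<xi> _ policy by (rule policy_improvement[where \<xi> = \<xi>]) (simp add: \<xi>_def)
  then show ?thesis by (simp add: d_def)
qed

section \<open>Perfect information\<close>

lemma pcl_cong:
  assumes "\<And>t. t < k \<Longrightarrow> d t = d' t"
  shows "pcl A B L m0 x0 w d k = pcl A B L m0 x0 w d' k"
  using assms
proof (induction k)
  case (Suc k)
  then have "pcl A B L m0 x0 w d k = pcl A B L m0 x0 w d' k" "d k = d' k" by auto
  then show ?case by (simp add: fun_eq_iff)
qed (simp add: fun_eq_iff)

lemma pVoI_cong:
  assumes "\<And>t. t < k \<Longrightarrow> d t = d' t"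
  shows "pVoI M A B Q R th N m0 x0 w dbar d k = pVoI M A B Q R th N m0 x0 w dbar d' k"
proof -
  have st: "pcl A B L m0 x0 w d t = pcl A B L m0 x0 w d' t" if "t \<le> k" for t L
    using assms that by (intro pcl_cong) auto
  have "pinfo M A B L m0 x0 w d k = pinfo M A B L m0 x0 w d' k" for L
    unfolding pinfo_def by (intro arg_cong[where f = "sigma (space M)"] SUP_cong refl) (simp add: st)
  moreover have "pJ A B Q R th N m0 x0 w dbar d k b = pJ A B Q R th N m0 x0 w dbar d' k b" for b
    by (rule ext) (simp only: pJ_def switch_at_cong[of k d d', OF assms])
  ultimately show ?thesis
    by (intro ext) (simp add: pVoI_def prho_def st Let_def)
qed

lemma pplus_pre_eq_pplus:
  "t < k \<Longrightarrow> pplus_pre M A B Q R th N m0 x0 w dbar k t = pplus M A B Q R th N m0 x0 w dbar t"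
  by (induction k) (auto simp: pplus_def less_Suc_eq)

lemma pplus_iff:
  "pplus M A B Q R th N m0 x0 w dbar k \<omega> \<longleftrightarrow>
    0 \<le> pVoI M A B Q R th N m0 x0 w dbar (pplus M A B Q R th N m0 x0 w dbar) k \<omega>"
proof -
  have "pVoI M A B Q R th N m0 x0 w dbar (pplus_pre M A B Q R th N m0 x0 w dbar k) k
    = pVoI M A B Q R th N m0 x0 w dbar (pplus M A B Q R th N m0 x0 w dbar) k"
    by (intro pVoI_cong pplus_pre_eq_pplus)
  then show ?thesis by (simp add: pplus_def[of _ _ _ _ _ _ _ _ _ _ _ k])
qed

text \<open>With identity observation and zero observation noise the gain is \<open>A P\<close>
  times the inverse of \<open>P\<close>, where definiteness lets the inverse cancel.\<close>

lemma kgain_perfect: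
  assumes "pd_mat P"
  shows "kgain A (\<lambda>_. mat 1) (\<lambda>_. 0) k P = A k"
proof -
  have "kgain A (\<lambda>_. mat 1) (\<lambda>_. 0) k P = A k ** (P ** matrix_inv P)"
    by (simp add: kgain_def matrix_mul_assoc)
  also have "\<dots> = A k" by (simp add: matrix_inv_mult[OF pd_mat_invertible[OF assms]])
  finally show ?thesis .
qed

text \<open>Perfect information is noiseless observation of the whole state. The initial covariance does
  not enter the perfect-information loop; it is taken to be \<open>mat 1\<close> because \<open>M0\<close> may be singular
  while the gain equals \<open>A k\<close> only for an invertible covariance.\<close>

lemma icl_perfect:
  assumes W: "\<And>t. t \<le> N \<Longrightarrow> pd_mat (W t)" and k: "k \<le> Suc N"
  shows "fst (icl A B (\<lambda>_. mat 1) W (\<lambda>_. 0) L m0 (mat 1) x0 w (\<lambda>_ _. 0) d k \<omega>)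
      = fst (pcl A B L m0 x0 w d k \<omega>)"
    and "fst (snd (icl A B (\<lambda>_. mat 1) W (\<lambda>_. 0) L m0 (mat 1) x0 w (\<lambda>_ _. 0) d k \<omega>))
      = snd (pcl A B L m0 x0 w d k \<omega>)"
    and "pd_mat (snd (snd (icl A B (\<lambda>_. mat 1) W (\<lambda>_. 0) L m0 (mat 1) x0 w (\<lambda>_ _. 0) d k \<omega>)))"
proof -
  let ?icl = "icl A B (\<lambda>_. mat 1) W (\<lambda>_. 0) L m0 (mat 1) x0 w (\<lambda>_ _. 0) d"
  have "(fst (?icl k \<omega>), fst (snd (?icl k \<omega>))) = pcl A B L m0 x0 w d k \<omega> \<and> pd_mat (snd (snd (?icl k \<omega>)))"
    using k
  proof (induction k)
    case 0
    show ?case by (simp add: pd_mat_def)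
  next
    case (Suc k)
    obtain x xh P where st: "?icl k \<omega> = (x, xh, P)" by (metis prod_cases3)
    then have IH: "pcl A B L m0 x0 w d k \<omega> = (x, xh)" "pd_mat P"
      using Suc by auto
    \<comment> \<open>This is the next covariance without transmission; with transmission the
      subtraction leaves \<open>W k\<close>. Both are definite.\<close>
    have "pd_mat (A k ** P ** transpose (A k) + W k)"
      using psd_mat_congruence[OF pd_mat_imp_psd_mat[OF IH(2)], of "transpose (A k)"] W[of k] Suc.prems
      by (intro pd_mat_psd_add) auto
    then show ?case
      using IH W[of k] Suc.prems
      by (simp add: st kgain_perfect[OF IH(2)] Let_def)
  qed
  then show "fst (?icl k \<omega>) = fst (pcl A B L m0 x0 w d k \<omega>)"
    "fst (snd (?icl k \<omega>)) = snd (pcl A B L m0 x0 w d k \<omega>)" "pd_mat (snd (snd (?icl k \<omega>)))"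
    by (metis fst_conv, metis snd_conv, simp)
qed

lemma perfect_improvement:
  assumes model: "perfect_model M A B Q R W th N m0 M0 x0 w"
  shows "pPsi M A B Q R th N m0 x0 w (pplus M A B Q R th N m0 x0 w dbar)
    \<le> pPsi M A B Q R th N m0 x0 w (\<lambda>k _. dbar k)"
proof -
  interpret prob_space M using model by (simp add: perfect_model_def)
  define X where "X i = (case i of X0 \<Rightarrow> x0 | Wn k \<Rightarrow> w k | Vn k \<Rightarrow> x0)" for i
  let ?J = "\<lambda>k. insert X0 (Wn ` {..<k})"
  have Wpd: "pd_mat (W k)" and gw: "gaussian_rv M (w k) 0 (W k)" if "k \<le> N" for k
    using model that by (auto simp: perfect_model_def)
  note W = pd_mat_imp_psd_mat[OF Wpd]
  have gx: "gaussian_rv M x0 m0 M0" "psd_mat M0" using model by (auto simp: perfect_model_def)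
  have indep: "indep_vars (\<lambda>_. borel) X (insert X0 (Wn ` {..N}))"
    using model unfolding perfect_model_def X_def by blast
  interpret triggered_lq M A B Q R N "\<lambda>_. mat 1" W "\<lambda>_. 0" th m0 "mat 1" x0 w "\<lambda>_ _. 0"
    "\<lambda>k. generated_info M X (?J k)"
  proof unfold_locales
    fix k :: nat and h :: "'a \<Rightarrow> real" and a
    show "k \<le> Suc N \<Longrightarrow> psd_mat (Q k)" "k \<le> N \<Longrightarrow> pd_mat (R k)" "k \<le> N \<Longrightarrow> 0 \<le> th k"
      using model by (auto simp: perfect_model_def)
    show "sq_integrable M x0" by (rule gaussian_rv_sq_integrable[OF gx])
    show "k \<le> N \<Longrightarrow> sq_integrable M (w k)" by (rule gaussian_rv_sq_integrable[OF gw W])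
    show "sq_integrable M (\<lambda>_. 0)" by (rule sq_integrable_const)
    show "space (generated_info M X (?J k)) = space M" by (rule space_generated_info)
    show "x0 \<in> borel_measurable (generated_info M X (?J k))"
      using measurable_generated_info[of X0 "?J k" X M] by (simp add: X_def)
    show "w t \<in> borel_measurable (generated_info M X (?J k))" if "t < k" for t
      using measurable_generated_info[of "Wn t" "?J k" X M] that by (simp add: X_def)
    show "(\<lambda>_. 0) \<in> borel_measurable (generated_info M X (?J k))" by simp
    show "(\<integral>\<omega>. h \<omega> * (a \<bullet> w k \<omega>) \<partial>M) = 0"
      if k: "k \<le> N" and h: "h \<in> borel_measurable (generated_info M X (?J k))" "sq_integrable M h"
      using k by (intro noise_orthogonal[OF indep _ _ _ h gw[OF k] W[OF k] measurable_ident, of "Wn k"])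
        (auto simp: X_def)
  qed
  note st = icl_perfect[of N W, OF Wpd]
  have psi: "pPsi M A B Q R th N m0 x0 w d
      = iPsi M A B (\<lambda>_. mat 1) W (\<lambda>_. 0) Q R th N m0 (mat 1) x0 w (\<lambda>_ _. 0) d" for d
    by (simp add: pPsi_def iPsi_def pcost_def icost_def Let_def st)
  have info: "pinfo M A B L m0 x0 w d k = info d k" if "k \<le> N" for d k
  proof -
    have "(\<lambda>\<omega>. fst (pcl A B L m0 x0 w d t \<omega>)) = y d t" if "t \<le> k" for t
      using that \<open>k \<le> N\<close> by (simp add: st)
    then show ?thesis
      unfolding pinfo_def iinfo_def
      by (intro arg_cong[where f = "sigma (space M)"] SUP_cong refl) auto
  qed
  have tail: "pJ A B Q R th N m0 x0 w dbar d k b = tail dbar d k b" for d k b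
    unfolding pJ_def iJ_def Let_def fun_eq_iff by (intro allI sum.cong) (auto simp: st)
  define d where "d = pplus M A B Q R th N m0 x0 w dbar"
  have corr: "corr d k \<omega> = A k *v err d k \<omega>" if "k \<le> N" for k \<omega>
  proof -
    have "kgain A (\<lambda>_. mat 1) (\<lambda>_. 0) k (cov d k \<omega>) = A k"
      using that by (intro kgain_perfect st(3)) auto
    then show ?thesis by simp
  qed
  \<comment> \<open>The correction is \<open>A k\<close> applied to the error, so twice the
    propagated error minus the correction is again the propagated error.\<close>
  have voi: "pVoI M A B Q R th N m0 x0 w dbar d k \<omega> = voi dbar (xs d) d k \<omega>" if "k \<le> N" for k \<omega>
    using that unfolding pVoI_def prho_def Let_def voi_def irho_def corr[OF that] info[OF that] tail
    by (simp add: st scaleR_2)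
  have policy: "d k \<omega> \<longleftrightarrow> 0 \<le> voi dbar (xs d) d k \<omega>" if "k \<le> N" for k \<omega>
    using voi[OF that] pplus_iff[of M A B Q R th N m0 x0 w dbar k \<omega>] by (simp add: d_def)
  have xs: "xs d k \<in> borel_measurable (info d k)" for k
    using y_info[of k k d] by simp
  have d: "adapted d" using policy xs by (intro adapted_voi_policy) auto
  \<comment> \<open>The state is itself observed, so it is a version of its own conditional
    expectation.\<close>
  have "AE \<omega> in M. xs d k \<omega> $ i = real_cond_exp M (info d k) (\<lambda>\<omega>. xs d k \<omega> $ i) \<omega>"
    if k: "k \<le> N" for k i
  proof -
    note dm = adapted_measurable[OF d]
    interpret F: finite_measure_subalgebra M "info d k"
      by unfold_locales (rule info_subalgebra[of d, OF dm k])
    have "(\<lambda>\<omega>. axis i 1 \<bullet> xs d k \<omega>) \<in> borel_measurable (info d k)" using xs by measurable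
    moreover have "integrable M (\<lambda>\<omega>. axis i 1 \<bullet> xs d k \<omega>)"
      using sq_integrable_loop(1)[of d, OF dm] k
      by (intro sq_integrable_inner_integrable sq_integrable_const) auto
    ultimately show ?thesis
      using F.real_cond_exp_F_meas[of "\<lambda>\<omega>. xs d k \<omega> $ i"] by (auto simp: inner_axis' eq_commute)
  qed
  then have "iPsi M A B (\<lambda>_. mat 1) W (\<lambda>_. 0) Q R th N m0 (mat 1) x0 w (\<lambda>_ _. 0) d
    \<le> iPsi M A B (\<lambda>_. mat 1) W (\<lambda>_. 0) Q R th N m0 (mat 1) x0 w (\<lambda>_ _. 0) (\<lambda>k _. dbar k)"
    using xs policy by (intro policy_improvement[OF d, where \<xi> = "xs d"]) auto
  then show ?thesis by (simp add: psi d_def)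
qed

theorem theorem4:
  fixes M :: "'w measure"
    and A :: "nat \<Rightarrow> real^'n^'n" and B :: "nat \<Rightarrow> real^'m^'n"
    and Q :: "nat \<Rightarrow> real^'n^'n" and R :: "nat \<Rightarrow> real^'m^'m" and W :: "nat \<Rightarrow> real^'n^'n"
    and th :: "nat \<Rightarrow> real" and N :: nat and m0 :: "real^'n" and M0 :: "real^'n^'n"
    and x0 :: "'w \<Rightarrow> real^'n" and w :: "nat \<Rightarrow> 'w \<Rightarrow> real^'n"
    and kp :: nat and dbar :: "nat \<Rightarrow> bool"
  assumes model: "perfect_model M A B Q R W th N m0 M0 x0 w"
    and periodic: "periodic_policy kp dbar"
  shows "pPsi M A B Q R th N m0 x0 w (pplus M A B Q R th N m0 x0 w dbar)
           \<le> pPsi M A B Q R th N m0 x0 w (\<lambda>k _. dbar k)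
         \<and> (\<forall>(C :: nat \<Rightarrow> real^'n^'p) (V :: nat \<Rightarrow> real^'p^'p) (v :: nat \<Rightarrow> 'w \<Rightarrow> real^'p).
              imperfect_model M A C V N x0 w v \<longrightarrow>
              iPsi M A B C W V Q R th N m0 M0 x0 w v
                   (iplus M A B C W V Q R th N m0 M0 x0 w v dbar)
              \<le> iPsi M A B C W V Q R th N m0 M0 x0 w v (\<lambda>k _. dbar k))"
  using perfect_improvement[OF model] imperfect_improvement[OF model] by blast

end
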